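(* Let $N\ge 2$ be an integer, $p\in(1,\infty)$, and $\alpha\in\mathbb{R}$ be such that $N>p+\alpha$. Assume that $g\in L^q(\mathbb{S}^{N-1})$, where $q=\frac{N-1}{p}$ if $p<N-1$, $q=1$ if $p>N-1$, and $q>1$ (arbitrary) if $p=N-1$. Then there exists a constant $C>0$, independent of $u$, such that $$\int_{\mathbb{R}^N}\frac{g(x/|x|)}{|x|^{p+\alpha}}|u(x)|^p\,dx\le C\,\|g\|_{L^q(\mathbb{S}^{N-1})}\int_{\mathbb{R}^N}\frac{|\nabla u(x)|^p}{|x|^\alpha}\,dx,\qquad\forall\,u\in \mathcal{C}_c^\infty(\mathbb{R}^N).$$
   Context: $\mathbb{S}^{N-1}$ is the unit sphere in $\mathbb{R}^N$ and $d\vartheta$ is the surface measure on it induced by the Lebesgue measure of $\mathbb{R}^N$. For a measurable function $g$ on $\mathbb{S}^{N-1}$ and $q\in[1,\infty)$, $\|g\|_{L^q(\mathbb{S}^{N-1})}=\left(\int_{\mathbb{S}^{N-1}}|g(\vartheta)|^q\,d\vartheta\right)^{1/q}$. $\mathcal{C}_c^\infty(\mathbb{R}^N)$ denotes the smooth compactly supported functions on $\mathbb{R}^N$. *)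

theory Defs
  imports "HOL-Analysis.Analysis"
begin

text \<open>
  Surface measure on the unit sphere induced by Lebesgue measure on the \<open>N\<close>-dimensional space:
  \<open>N\<close> times the volume of the part of the unit ball in the cone over \<open>A\<close>, i.e. the measure
  \<open>\<sigma>\<close> of polar coordinates \<open>dx = r\<^sup>N\<^sup>-\<^sup>1 dr d\<sigma>\<close>. It is completed, so that measurability and
  null sets on the sphere are the Lebesgue ones.
\<close>

definition borel_sphere_measure :: "'a::euclidean_space measure" where
  "borel_sphere_measure =
     scale_measure (of_nat DIM('a))
       (distr (restrict_space lborel (cball 0 1 - {0})) (restrict_space borel (sphere 0 1))
          (\<lambda>x. x /\<^sub>R norm x))"

definition sphere_measure :: "'a::euclidean_space measure" where
  "sphere_measure = completion borel_sphere_measure"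

lemma radial_projection_measurable:
  "(\<lambda>x::'a::euclidean_space. x /\<^sub>R norm x)
     \<in> restrict_space lborel (cball 0 1 - {0}) \<rightarrow>\<^sub>M restrict_space borel (sphere 0 1)"
  by (rule measurable_restrict_space2)
     (auto simp: space_restrict_space intro!: measurable_restrict_space1)

lemma emeasure_borel_sphere_measure:
  fixes A :: "'a::euclidean_space set"
  assumes "A \<in> sets (restrict_space borel (sphere 0 1))"
  shows "emeasure borel_sphere_measure A =
           of_nat DIM('a) * emeasure lborel {x. 0 < norm x \<and> norm x \<le> 1 \<and> x /\<^sub>R norm x \<in> A}"
proof -
  have "{x. 0 < norm x \<and> norm x \<le> 1 \<and> x /\<^sub>R norm x \<in> A} =
      (\<lambda>x. x /\<^sub>R norm x) -` A \<inter> (cball 0 1 - {0})"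
    by auto
  then show ?thesis
    unfolding borel_sphere_measure_def
    by (simp add: emeasure_distr[OF radial_projection_measurable assms]
        emeasure_restrict_space space_restrict_space)
qed

definition Lq_sphere :: "real \<Rightarrow> ('a::euclidean_space \<Rightarrow> real) \<Rightarrow> bool" where
  "Lq_sphere q g \<longleftrightarrow>
     g \<in> borel_measurable sphere_measure \<and>
     integrable sphere_measure (\<lambda>\<theta>. \<bar>g \<theta>\<bar> powr q)"

definition Lq_sphere_norm :: "real \<Rightarrow> ('a::euclidean_space \<Rightarrow> real) \<Rightarrow> real" where
  "Lq_sphere_norm q g = (LINT \<theta>|sphere_measure. \<bar>g \<theta>\<bar> powr q) powr (1 / q)"

primrec C_k :: "nat \<Rightarrow> ('a::euclidean_space \<Rightarrow> real) \<Rightarrow> bool" where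
  "C_k 0 u \<longleftrightarrow> continuous_on UNIV u"
| "C_k (Suc k) u \<longleftrightarrow>
     (\<forall>x. u differentiable at x) \<and> (\<forall>v. C_k k (\<lambda>x. frechet_derivative u (at x) v))"

definition smooth_compactly_supported :: "('a::euclidean_space \<Rightarrow> real) \<Rightarrow> bool" where
  "smooth_compactly_supported u \<longleftrightarrow> (\<forall>k. C_k k u) \<and> compact (closure {x. u x \<noteq> 0})"

definition gradient :: "('a::euclidean_space \<Rightarrow> real) \<Rightarrow> 'a \<Rightarrow> 'a" where
  "gradient u x = (THE D. GDERIV u x :> D)"

end

theory Submission
  imports Defs
begin

text \<open>
  Write \<open>N\<close> for the dimension. On each sphere \<open>|x| = t\<close> the Hoelder inequality separates \<open>g\<close> from
  \<open>|u|\<^sup>p\<close>, and the Sobolev embedding of an \<open>(N-1)\<close>-dimensional surface controls the remaining power of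
  \<open>u\<close> by \<open>t |\<nabla>u|\<close> and \<open>u\<close> on that sphere: the critical embedding for \<open>p < N-1\<close>, any finite exponent
  for \<open>p = N-1\<close>, and a bound of the supremum for \<open>p > N-1\<close>; these are exactly the three choices of \<open>q\<close>.
  Integrating over \<open>t\<close> bounds the left-hand side by
  \<open>\<parallel>g\<parallel> \<integral> |x|\<^sup>-\<^sup>p\<^sup>-\<^sup>\<alpha> |u|\<^sup>p + |x|\<^sup>-\<^sup>\<alpha> |\<nabla>u|\<^sup>p\<close>, and the classical Hardy inequality, valid because
  \<open>p + \<alpha> < N\<close>, absorbs the first summand into the second.

  Spheres are replaced by boundaries of cubes, so that no calculus on a curved surface is needed. The
  \<open>2N\<close> pyramids over the faces \<open>x \<bullet> b = \<plusminus>1\<close> of the cube cover the space, each has coordinates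
  \<open>x = t (\<plusminus>b + \<Sum> y\<^sub>c c)\<close> with \<open>t > 0\<close> and \<open>y\<close> in the cube \<open>[-1, 1]\<^sup>N\<^sup>-\<^sup>1\<close>, and \<open>dx = t\<^sup>N\<^sup>-\<^sup>1 dt dy\<close>
  (\<open>nn_integral_pyramid\<close>). As \<open>|x|\<close> and \<open>t\<close> are comparable, all weights pass between \<open>x\<close> and \<open>t\<close>
  at the cost of constants, and the norm of \<open>g\<close> over a face is bounded by its norm over the sphere
  (\<open>nn_integral_cube_le_sphere\<close>).

  The embeddings on the cube are elementary. For \<open>p\<close> below the dimension of the cube, a function is bounded
  by its integral along each coordinate line, the product of these bounds is integrated with the
  Gagliardo--Nirenberg argument (\<open>Gagliardo\<close>), and the result is applied to a power of \<open>|u|\<close>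
  (\<open>Sobolev_cube\<close>). For \<open>p\<close> above the dimension, one averages the fundamental theorem of calculus over all
  segments from a fixed point (\<open>Morrey_cube\<close>). \<open>weighted_Sobolev_cube\<close> combines the cases. The Hardy
  inequality comes from the fundamental theorem along rays, the Hoelder inequality and the scaling of
  Lebesgue measure (\<open>Hardy_inequality\<close>).

  All estimates are carried out for integrals with values in the extended nonnegative reals, where no
  integrability has to be known in advance; the integrability claims then follow from the estimates.
\<close>

section \<open>Powers of extended nonnegative reals and the Hoelder inequality\<close>

text \<open>
  The value at \<open>top\<close> is the expected one for positive exponents, the only ones of interest here. Like
  \<open>powr\<close> on the reals it gives \<open>0 epowr a = 0\<close> for all \<open>a\<close>, which makes the power multiplicative and
  compatible with indicator functions without side conditions.
\<close>

definition epowr :: "ennreal \<Rightarrow> real \<Rightarrow> ennreal" (infixr "epowr" 80) where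
  "x epowr a = (if x = top then top else ennreal (enn2real x powr a))"

lemma measurable_epowr [measurable]:
  assumes "f \<in> borel_measurable M"
  shows "(\<lambda>x. f x epowr a) \<in> borel_measurable M"
  using assms unfolding epowr_def by measurable

lemma ennreal_epowr: "0 \<le> x \<Longrightarrow> ennreal x epowr a = ennreal (x powr a)"
  by (simp add: epowr_def)

lemma top_epowr [simp]: "top epowr a = top"
  by (simp add: epowr_def)

lemma zero_epowr [simp]: "0 epowr a = 0"
  by (simp add: epowr_def)

lemma one_epowr [simp]: "1 epowr a = 1"
  by (simp add: epowr_def)

lemma epowr_one [simp]: "x epowr 1 = x"
  by (cases x) (auto simp: epowr_def)

lemma indicator_epowr [simp]: "indicator A x epowr a = indicator A x"
  by (auto simp: indicator_def)

lemma epowr_eq_top_iff [simp]: "x epowr a = top \<longleftrightarrow> x = top"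
  by (simp add: epowr_def)

lemma epowr_eq_0_iff [simp]: "x epowr a = 0 \<longleftrightarrow> x = 0"
  by (cases x) (auto simp: epowr_def ennreal_eq_0_iff)

lemma epowr_mono:
  assumes "x \<le> y" "0 \<le> a"
  shows "x epowr a \<le> y epowr a"
  using assms by (cases x; cases y) (auto simp: epowr_def powr_mono2 top_unique)

lemma epowr_mult: "(x * y) epowr a = x epowr a * y epowr a"
proof (cases "x = 0 \<or> y = 0 \<or> x = top \<or> y = top")
  case True
  then show ?thesis
    by (auto simp: ennreal_mult_eq_top_iff ennreal_mult_top ennreal_top_mult)
next
  case False
  then show ?thesis
    by (cases x; cases y) (auto simp: epowr_def powr_mult simp flip: ennreal_mult)
qed

lemma epowr_epowr: "(x epowr a) epowr b = x epowr (a * b)"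
  by (cases x) (auto simp: epowr_def powr_powr)

lemma epowr_add: "x epowr a * x epowr b = x epowr (a + b)"
  by (cases x) (auto simp: epowr_def powr_add ennreal_mult_eq_top_iff simp flip: ennreal_mult)

lemma epowr_power:
  assumes "0 < n"
  shows "(x epowr a) ^ n = x epowr (real n * a)"
  using assms by (induction n rule: nat_induct_non_zero) (simp_all add: epowr_add algebra_simps)

lemma epowr_sum_le:
  assumes "0 \<le> a"
  shows "(x + y) epowr a \<le> ennreal (2 powr a) * (x epowr a + y epowr a)"
proof -
  have "x + y \<le> 2 * max x y"
    by (simp add: add_mono mult_2)
  then have "(x + y) epowr a \<le> (2 * max x y) epowr a"
    by (rule epowr_mono) (rule assms)
  also have "\<dots> = ennreal (2 powr a) * max x y epowr a"
    by (simp add: epowr_mult ennreal_epowr flip: ennreal_numeral)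
  also have "\<dots> \<le> ennreal (2 powr a) * (x epowr a + y epowr a)"
    by (intro mult_left_mono) (auto simp: max_def)
  finally show ?thesis .
qed

lemma weighted_arith_geom_mean:
  fixes x w :: "'i \<Rightarrow> real"
  assumes K: "finite K" "\<And>k. k \<in> K \<Longrightarrow> 0 < w k" "(\<Sum>k\<in>K. w k) = 1"
    and x: "\<And>k. k \<in> K \<Longrightarrow> 0 \<le> x k"
  shows "(\<Prod>k\<in>K. x k powr w k) \<le> (\<Sum>k\<in>K. w k * x k)"
proof (cases "\<exists>k\<in>K. x k = 0")
  case True
  then have "(\<Prod>k\<in>K. x k powr w k) = 0"
    using K(1) by auto
  also have "0 \<le> (\<Sum>k\<in>K. w k * x k)"
    using K x by (intro sum_nonneg mult_nonneg_nonneg) (auto simp: less_imp_le)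
  finally show ?thesis .
next
  case False
  with x have pos: "0 < x k" if "k \<in> K" for k
    using that by (metis less_eq_real_def)
  have ne: "K \<noteq> {}"
    using K(3) by auto
  have "(\<Sum>k\<in>K. w k * ln (x k)) \<le> ln (\<Sum>k\<in>K. w k *\<^sub>R x k)"
    using K pos ne by (intro concave_on_sum[of K "{0<..}"] ln_concave) (auto simp: less_imp_le)
  moreover have "(\<Sum>k\<in>K. w k *\<^sub>R x k) > 0"
    using K pos ne by (intro sum_pos) auto
  ultimately have "exp (\<Sum>k\<in>K. w k * ln (x k)) \<le> (\<Sum>k\<in>K. w k *\<^sub>R x k)"
    by (simp add: ln_ge_iff)
  moreover have "(\<Prod>k\<in>K. x k powr w k) = exp (\<Sum>k\<in>K. w k * ln (x k))"
    using K(1) pos by (simp add: exp_sum powr_def less_imp_neq[THEN not_sym])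
  ultimately show ?thesis
    by simp
qed

lemma weighted_arith_geom_mean_ennreal:
  fixes x :: "'i \<Rightarrow> ennreal"
  assumes K: "finite K" "\<And>k. k \<in> K \<Longrightarrow> 0 < w k" "(\<Sum>k\<in>K. w k) = 1"
  shows "(\<Prod>k\<in>K. x k epowr w k) \<le> (\<Sum>k\<in>K. ennreal (w k) * x k)"
proof (cases "\<exists>k\<in>K. x k = top")
  case True
  then obtain k where k: "k \<in> K" "x k = top"
    by blast
  then have "ennreal (w k) * x k = top"
    using K(2)[of k] by (simp add: ennreal_mult_top)
  moreover have "ennreal (w k) * x k \<le> (\<Sum>k\<in>K. ennreal (w k) * x k)"
    using k K(1) by (intro member_le_sum) auto
  ultimately show ?thesis
    by (simp add: top_unique)
next
  case False
  define y where "y k = enn2real (x k)" for k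
  have xy: "x k = ennreal (y k)" if "k \<in> K" for k
    using False that by (auto simp: y_def less_top)
  have y: "0 \<le> y k" for k
    by (simp add: y_def)
  have "(\<Prod>k\<in>K. x k epowr w k) = ennreal (\<Prod>k\<in>K. y k powr w k)"
    using y by (simp add: xy ennreal_epowr prod_ennreal)
  also have "\<dots> \<le> ennreal (\<Sum>k\<in>K. w k * y k)"
    using K y by (intro ennreal_leI weighted_arith_geom_mean) auto
  also have "\<dots> = (\<Sum>k\<in>K. ennreal (w k) * x k)"
    using K(2) y by (simp add: xy sum_ennreal less_imp_le ennreal_mult flip: sum_ennreal cong: sum.cong)
  finally show ?thesis .
qed

text \<open>
  After division by the integrals \<open>A k\<close> of the factors, the weighted inequality of arithmetic and
  geometric means bounds the integrand by a convex combination of functions with integral \<open>1\<close>. If some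
  \<open>A k\<close> vanishes, so does the integrand almost everywhere, and if otherwise some \<open>A k\<close> is infinite,
  so is the right-hand side.
\<close>

theorem Hoelder_prod:
  fixes f :: "'i \<Rightarrow> 'a \<Rightarrow> ennreal"
  assumes K: "finite K" "\<And>k. k \<in> K \<Longrightarrow> 0 < w k" "(\<Sum>k\<in>K. w k) = 1"
    and f [measurable]: "\<And>k. k \<in> K \<Longrightarrow> f k \<in> borel_measurable M"
  shows "(\<integral>\<^sup>+x. (\<Prod>k\<in>K. f k x epowr w k) \<partial>M) \<le> (\<Prod>k\<in>K. (\<integral>\<^sup>+x. f k x \<partial>M) epowr w k)"
proof -
  define A where "A k = (\<integral>\<^sup>+x. f k x \<partial>M)" for k
  consider k where "k \<in> K" "A k = 0" | k where "k \<in> K" "A k = top" "\<forall>k\<in>K. A k \<noteq> 0"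
    | "\<forall>k\<in>K. A k \<noteq> 0 \<and> A k \<noteq> top"
    by blast
  then show ?thesis
  proof cases
    case 1
    then have "AE x in M. f k x = 0"
      by (simp add: A_def nn_integral_0_iff_AE)
    then have "AE x in M. (\<Prod>k\<in>K. f k x epowr w k) = 0"
      by eventually_elim (use 1 K in auto)
    then have "(\<integral>\<^sup>+x. (\<Prod>k\<in>K. f k x epowr w k) \<partial>M) = (\<integral>\<^sup>+x. 0 \<partial>M)"
      by (rule nn_integral_cong_AE)
    then show ?thesis
      by simp
  next
    case 2
    then have "(\<Prod>k\<in>K. A k epowr w k) = top"
      using K(1) by (auto simp: ennreal_prod_eq_top)
    then show ?thesis
      by (simp add: A_def)
  next
    case 3
    have "(\<Prod>k\<in>K. f k x epowr w k)
        \<le> (\<Prod>k\<in>K. A k epowr w k) * (\<Sum>k\<in>K. ennreal (w k) * (f k x / A k))" for x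
    proof -
      have "A k epowr w k * (f k x / A k) epowr w k = f k x epowr w k" if "k \<in> K" for k
        using 3 that
        by (simp add: ennreal_mult_divide_eq ennreal_times_divide mult.commute[of "A k"] flip: epowr_mult)
      then have "(\<Prod>k\<in>K. f k x epowr w k)
          = (\<Prod>k\<in>K. A k epowr w k) * (\<Prod>k\<in>K. (f k x / A k) epowr w k)"
        by (simp flip: prod.distrib)
      also have "\<dots> \<le> (\<Prod>k\<in>K. A k epowr w k) * (\<Sum>k\<in>K. ennreal (w k) * (f k x / A k))"
        by (intro mult_left_mono weighted_arith_geom_mean_ennreal K) auto
      finally show ?thesis .
    qed
    then have "(\<integral>\<^sup>+x. (\<Prod>k\<in>K. f k x epowr w k) \<partial>M)
        \<le> (\<integral>\<^sup>+x. (\<Prod>k\<in>K. A k epowr w k) * (\<Sum>k\<in>K. ennreal (w k) * (f k x / A k)) \<partial>M)"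
      by (intro nn_integral_mono) auto
    also have "\<dots> = (\<Prod>k\<in>K. A k epowr w k) * (\<Sum>k\<in>K. ennreal (w k) * (A k / A k))"
      unfolding divide_ennreal_def
      by (simp add: nn_integral_cmult nn_integral_sum nn_integral_multc A_def)
    also have "(\<Sum>k\<in>K. ennreal (w k) * (A k / A k)) = (\<Sum>k\<in>K. ennreal (w k))"
      using 3 by (intro sum.cong) (auto simp: less_top)
    also have "\<dots> = 1"
      using K by (simp add: sum_ennreal less_imp_le)
    finally show ?thesis
      by (simp add: A_def)
  qed
qed

corollary Hoelder:
  fixes f g :: "'a \<Rightarrow> ennreal"
  assumes [measurable]: "f \<in> borel_measurable M" "g \<in> borel_measurable M"
    and "0 < a" "0 < b" "a + b = 1"
  shows "(\<integral>\<^sup>+x. f x epowr a * g x epowr b \<partial>M)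
      \<le> (\<integral>\<^sup>+x. f x \<partial>M) epowr a * (\<integral>\<^sup>+x. g x \<partial>M) epowr b"
  using Hoelder_prod[of "UNIV::bool set" "\<lambda>k. if k then a else b" "\<lambda>k. if k then f else g" M] assms
  by (simp add: UNIV_bool mult.commute)

section \<open>The Gagliardo product inequality\<close>

text \<open>
  The integral over the coordinates in \<open>I\<close>, still regarded as a function on the product over all of
  \<open>J\<close>: this keeps one domain throughout an induction on \<open>I\<close>.
\<close>

definition partial_nn_integral ::
    "('i \<Rightarrow> 'a measure) \<Rightarrow> 'i set \<Rightarrow> 'i set \<Rightarrow> (('i \<Rightarrow> 'a) \<Rightarrow> ennreal) \<Rightarrow> ('i \<Rightarrow> 'a) \<Rightarrow> ennreal" where
  "partial_nn_integral M J I f x = (\<integral>\<^sup>+y. f (merge I J (y, x)) \<partial>PiM I M)"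

lemma measurable_fun_upd_PiM:
  assumes "a \<in> J" "x \<in> space (PiM J M)"
  shows "(\<lambda>s. x(a := s)) \<in> M a \<rightarrow>\<^sub>M PiM J M"
proof (rule measurable_PiM_single')
  show "(\<lambda>s. (x(a := s)) i) \<in> M a \<rightarrow>\<^sub>M M i" if "i \<in> J" for i
    using that assms by (cases "i = a") (auto simp: space_PiM PiE_def Pi_def)
qed (use assms in \<open>auto simp: space_PiM PiE_def extensional_def Pi_def\<close>)

lemma (in product_sigma_finite) measurable_partial_nn_integral:
  assumes f: "f \<in> borel_measurable (PiM J M)" and I: "finite I" "I \<subseteq> J"
  shows "partial_nn_integral M J I f \<in> borel_measurable (PiM J M)"
proof -
  interpret I: finite_product_sigma_finite M I by standard (rule I)
  have "merge I J \<in> PiM I M \<Otimes>\<^sub>M PiM J M \<rightarrow>\<^sub>M PiM J M"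
    using measurable_merge[of I J M] I by (simp add: Un_absorb1)
  with f have [measurable]: "(\<lambda>z. f (merge I J z)) \<in> borel_measurable (PiM I M \<Otimes>\<^sub>M PiM J M)"
    by (rule measurable_compose[rotated])
  have "(\<lambda>x. \<integral>\<^sup>+y. f (merge I J (y, x)) \<partial>PiM I M) \<in> borel_measurable (PiM J M)"
    by (rule I.borel_measurable_nn_integral) measurable
  then show ?thesis
    unfolding partial_nn_integral_def[abs_def] .
qed

lemma (in product_sigma_finite) partial_nn_integral_empty:
  "x \<in> space (PiM J M) \<Longrightarrow> partial_nn_integral M J {} f x = f x"
  unfolding partial_nn_integral_def
  by (subst nn_integral_empty) (auto simp: merge_def space_PiM PiE_def extensional_def intro!: arg_cong[of _ _ f])

lemma (in product_sigma_finite) partial_nn_integral_full: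
  "partial_nn_integral M J J f x = (\<integral>\<^sup>+y. f y \<partial>PiM J M)"
  unfolding partial_nn_integral_def
  by (intro nn_integral_cong arg_cong[of _ _ f])
     (auto simp: merge_def space_PiM PiE_def extensional_def fun_eq_iff)

lemma (in product_sigma_finite) partial_nn_integral_singleton:
  assumes f: "f \<in> borel_measurable (PiM J M)" and "a \<in> J" and x: "x \<in> space (PiM J M)"
  shows "partial_nn_integral M J {a} f x = (\<integral>\<^sup>+s. f (x(a := s)) \<partial>M a)"
proof -
  have "(\<lambda>s. x(a := s)) \<in> M a \<rightarrow>\<^sub>M PiM J M"
    using \<open>a \<in> J\<close> x by (rule measurable_fun_upd_PiM)
  then have "(\<lambda>s. f (x(a := s))) \<in> borel_measurable (M a)"
    using f by measurable
  from product_nn_integral_singleton[OF this] show ?thesis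
    unfolding partial_nn_integral_def using \<open>a \<in> J\<close> x
    by (subst (asm) nn_integral_cong[of "PiM {a} M" _ "\<lambda>y. f (merge {a} J (y, x))"])
       (auto simp: merge_def fun_eq_iff space_PiM PiE_def extensional_def intro!: arg_cong[of _ _ f])
qed

lemma (in product_sigma_finite) partial_nn_integral_insert:
  assumes f: "f \<in> borel_measurable (PiM J M)"
    and I: "finite I" "insert a I \<subseteq> J" "a \<notin> I" and x: "x \<in> space (PiM J M)"
  shows "partial_nn_integral M J (insert a I) f x
    = (\<integral>\<^sup>+s. partial_nn_integral M J I f (x(a := s)) \<partial>M a)"
proof -
  have "(\<lambda>y. merge (insert a I) J (y, x)) \<in> PiM (insert a I) M \<rightarrow>\<^sub>M PiM J M"
    using I measurable_compose[OF measurable_Pair2'[OF x] measurable_merge, of "insert a I"]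
    by (simp add: Un_absorb1 del: Un_insert_left)
  with f have "(\<lambda>y. f (merge (insert a I) J (y, x))) \<in> borel_measurable (PiM (insert a I) M)"
    by (rule measurable_compose[rotated])
  from product_nn_integral_insert_rev[OF I(1) I(3) this] show ?thesis
    unfolding partial_nn_integral_def using I
    by (subst (asm) nn_integral_cong[of "M a" _ "\<lambda>s. \<integral>\<^sup>+y. f (merge I J (y, x(a := s))) \<partial>PiM I M"])
       (auto simp: merge_def fun_eq_iff intro!: nn_integral_cong arg_cong[of _ _ f])
qed

lemma partial_nn_integral_upd_same:
  assumes "a \<in> I"
  shows "partial_nn_integral M J I f (x(a := s)) = partial_nn_integral M J I f x"
  unfolding partial_nn_integral_def using assms
  by (intro nn_integral_cong arg_cong[of _ _ f]) (auto simp: merge_def)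

text \<open>
  Induction on the set \<open>I\<close> of coordinates already integrated. When a further coordinate \<open>a\<close> is
  integrated, the factor with index \<open>a\<close> does not depend on it and comes out of the integral, while
  exactly \<open>card J - 1\<close> factors remain, so that the exponents \<open>\<theta>\<close> add up to \<open>1\<close> and the Hoelder
  inequality moves the integral inside each of them. Indexing all factors by \<open>insert j I\<close> treats the
  coordinates inside and outside \<open>I\<close> uniformly.
\<close>

lemma (in product_sigma_finite) Gagliardo_partial:
  assumes J: "finite J" "card J \<ge> 2"
    and h: "\<And>j. j \<in> J \<Longrightarrow> h j \<in> borel_measurable (PiM J M)"
    and I: "I \<subseteq> J" and x: "x \<in> space (PiM J M)"
  defines "\<theta> \<equiv> 1 / (real (card J) - 1)"
  shows "partial_nn_integral M J I (\<lambda>x. \<Prod>j\<in>J. partial_nn_integral M J {j} (h j) x epowr \<theta>) x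
    \<le> (\<Prod>j\<in>J. partial_nn_integral M J (insert j I) (h j) x epowr \<theta>)"
proof -
  let ?F = "\<lambda>x. \<Prod>j\<in>J. partial_nn_integral M J {j} (h j) x epowr \<theta>"
  have F: "?F \<in> borel_measurable (PiM J M)"
    using J h by (intro borel_measurable_prod_ennreal measurable_epowr measurable_partial_nn_integral) auto
  have "finite I"
    using I J finite_subset by blast
  then show ?thesis
    using I x
  proof (induction I arbitrary: x)
    case empty
    then show ?case
      by (simp add: partial_nn_integral_empty)
  next
    case (insert a I)
    then have a: "a \<in> J" "insert a I \<subseteq> J" "a \<notin> I" "finite I" "I \<subseteq> J"
      by auto
    note x = \<open>x \<in> space (PiM J M)\<close>
    let ?p = "\<lambda>j s. partial_nn_integral M J (insert j I) (h j) (x(a := s))"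
    have upd: "x(a := s) \<in> space (PiM J M)" if "s \<in> space (M a)" for s
      using a(1) x that by (auto simp: space_PiM PiE_def extensional_def Pi_def)
    have upd_meas: "(\<lambda>s. x(a := s)) \<in> M a \<rightarrow>\<^sub>M PiM J M"
      using a(1) x by (rule measurable_fun_upd_PiM)
    have p_meas: "?p j \<in> borel_measurable (M a)" if "j \<in> J" for j
      using that a h
      by (intro measurable_compose[OF upd_meas] measurable_partial_nn_integral) auto
    have "partial_nn_integral M J (insert a I) ?F x
        = (\<integral>\<^sup>+s. partial_nn_integral M J I ?F (x(a := s)) \<partial>M a)"
      using F a x by (intro partial_nn_integral_insert) auto
    also have "\<dots> \<le> (\<integral>\<^sup>+s. (\<Prod>j\<in>J. ?p j s epowr \<theta>) \<partial>M a)"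
      by (intro nn_integral_mono insert.IH upd a)
    also have "\<dots> = (\<integral>\<^sup>+s. partial_nn_integral M J (insert a I) (h a) x epowr \<theta>
        * (\<Prod>j\<in>J - {a}. ?p j s epowr \<theta>) \<partial>M a)"
      using J a by (intro nn_integral_cong)
        (simp add: prod.remove[OF J(1) a(1)] partial_nn_integral_upd_same)
    also have "\<dots> = partial_nn_integral M J (insert a I) (h a) x epowr \<theta>
        * (\<integral>\<^sup>+s. (\<Prod>j\<in>J - {a}. ?p j s epowr \<theta>) \<partial>M a)"
      using p_meas by (intro nn_integral_cmult borel_measurable_prod_ennreal measurable_epowr) auto
    also have "(\<integral>\<^sup>+s. (\<Prod>j\<in>J - {a}. ?p j s epowr \<theta>) \<partial>M a)
        \<le> (\<Prod>j\<in>J - {a}. (\<integral>\<^sup>+s. ?p j s \<partial>M a) epowr \<theta>)"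
      using J a p_meas by (intro Hoelder_prod) (auto simp: \<theta>_def card_Diff_singleton of_nat_diff)
    also have "\<dots> \<le> (\<Prod>j\<in>J - {a}. partial_nn_integral M J (insert j (insert a I)) (h j) x epowr \<theta>)"
    proof (intro prod_mono_ennreal epowr_mono)
      fix j assume j: "j \<in> J - {a}"
      show "(\<integral>\<^sup>+s. ?p j s \<partial>M a) \<le> partial_nn_integral M J (insert j (insert a I)) (h j) x"
        using partial_nn_integral_insert[of "h j" J "insert j I" a x] a j x h
        by (auto simp: insert_commute)
    qed (use J in \<open>auto simp: \<theta>_def\<close>)
    also have "partial_nn_integral M J (insert a I) (h a) x epowr \<theta> * \<dots>
        = (\<Prod>j\<in>J. partial_nn_integral M J (insert j (insert a I)) (h j) x epowr \<theta>)"
      using J a by (simp add: prod.remove[OF J(1) a(1)])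
    finally show ?case
      by (simp add: mult_left_mono)
  qed
qed

text \<open>
  A functional form of the inequality of Loomis and Whitney: the factor with index \<open>j\<close> is a
  function of all coordinates but the \<open>j\<close>-th, given as the integral of \<open>h j\<close> along the coordinate line.
\<close>

theorem (in product_sigma_finite) Gagliardo:
  assumes J: "finite J" "card J \<ge> 2"
    and h: "\<And>j. j \<in> J \<Longrightarrow> h j \<in> borel_measurable (PiM J M)"
  defines "\<theta> \<equiv> 1 / (real (card J) - 1)"
  shows "(\<integral>\<^sup>+x. (\<Prod>j\<in>J. (\<integral>\<^sup>+s. h j (x(j := s)) \<partial>M j) epowr \<theta>) \<partial>PiM J M)
    \<le> (\<Prod>j\<in>J. (\<integral>\<^sup>+x. h j x \<partial>PiM J M) epowr \<theta>)"
proof (cases "space (PiM J M) = {}")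
  case True
  then have "(\<integral>\<^sup>+x. (\<Prod>j\<in>J. (\<integral>\<^sup>+s. h j (x(j := s)) \<partial>M j) epowr \<theta>) \<partial>PiM J M)
      = (\<integral>\<^sup>+x. 0 \<partial>PiM J M)"
    by (intro nn_integral_cong) (use True in blast)
  then show ?thesis
    by simp
next
  case False
  then obtain x where x: "x \<in> space (PiM J M)"
    by blast
  have "(\<integral>\<^sup>+x. (\<Prod>j\<in>J. (\<integral>\<^sup>+s. h j (x(j := s)) \<partial>M j) epowr \<theta>) \<partial>PiM J M)
    = (\<integral>\<^sup>+x. (\<Prod>j\<in>J. partial_nn_integral M J {j} (h j) x epowr \<theta>) \<partial>PiM J M)"
    using h by (intro nn_integral_cong prod.cong) (simp_all add: partial_nn_integral_singleton)
  also have "\<dots> \<le> (\<Prod>j\<in>J. partial_nn_integral M J (insert j J) (h j) x epowr \<theta>)"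
    using Gagliardo_partial[OF J h order_refl x] by (simp add: partial_nn_integral_full \<theta>_def)
  finally show ?thesis
    by (simp add: insert_absorb partial_nn_integral_full)
qed

section \<open>Pointwise bounds from the fundamental theorem of calculus\<close>

lemma abs_increment_le_nn_integral:
  fixes f f' :: "real \<Rightarrow> real"
  assumes "a \<le> b"
    and "\<And>s. a \<le> s \<Longrightarrow> s \<le> b \<Longrightarrow> (f has_real_derivative f' s) (at s)"
    and "continuous_on {a..b} f'"
  shows "ennreal \<bar>f b - f a\<bar> \<le> (\<integral>\<^sup>+s. ennreal \<bar>f' s\<bar> * indicator {a..b} s \<partial>lborel)"
proof -
  have eq: "integral\<^sup>L lborel (\<lambda>s. indicator {a..b} s *\<^sub>R f' s) = f b - f a"
    using assms
    by (intro integral_FTC_atLeastAtMost)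
       (auto intro: has_field_derivative_at_within simp flip: has_real_derivative_iff_has_vector_derivative)
  have "integrable lborel (\<lambda>s. indicator {a..b} s *\<^sub>R f' s)"
    using borel_integrable_atLeastAtMost'[OF assms(3)] by (simp add: set_integrable_def)
  from integral_norm_bound_ennreal[OF this] show ?thesis
    unfolding eq
    unfolding real_norm_def
    by (rule order_trans) (auto intro!: nn_integral_mono simp: indicator_def)
qed

lemma measurable_ennreal_continuous_on_indicator:
  fixes f :: "real \<Rightarrow> real"
  assumes "continuous_on A f" "A \<in> sets borel"
  shows "(\<lambda>s. ennreal (f s) * indicator A s) \<in> borel_measurable borel"
proof -
  have "(\<lambda>s. ennreal (indicator A s *\<^sub>R f s)) \<in> borel_measurable borel"
    using borel_measurable_continuous_on_indicator[OF assms(2,1)] by measurable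
  also have "(\<lambda>s. ennreal (indicator A s *\<^sub>R f s)) = (\<lambda>s. ennreal (f s) * indicator A s)"
    by (auto simp: indicator_def)
  finally show ?thesis .
qed

text \<open>
  Averaging \<open>|f x| \<le> |f s| + \<integral> |f'|\<close> over \<open>s\<close> in \<open>[-1, 1]\<close>.
\<close>

lemma abs_le_nn_integral_Icc:
  fixes f f' :: "real \<Rightarrow> real"
  assumes x: "x \<in> {-1..1}"
    and f: "\<And>s. s \<in> {-1..1} \<Longrightarrow> (f has_real_derivative f' s) (at s)"
    and f': "continuous_on {-1..1} f'"
  shows "ennreal \<bar>f x\<bar> \<le> (\<integral>\<^sup>+s. ennreal (\<bar>f s\<bar> + \<bar>f' s\<bar>) * indicator {-1..1} s \<partial>lborel)"
proof -
  have contf: "continuous_on {-1..1} f"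
    using f by (meson DERIV_continuous_on has_field_derivative_at_within)
  have [measurable]: "(\<lambda>s. ennreal \<bar>f s\<bar> * indicator {-1..1} s) \<in> borel_measurable borel"
     "(\<lambda>s. ennreal \<bar>f' s\<bar> * indicator {-1..1} s) \<in> borel_measurable borel"
    using contf f' by (intro measurable_ennreal_continuous_on_indicator continuous_intros; simp)+
  define B where "B = (\<integral>\<^sup>+s. ennreal \<bar>f' s\<bar> * indicator {-1..1} s \<partial>lborel)"
  have incr: "ennreal \<bar>f v - f u\<bar> \<le> B" if "u \<in> {-1..1}" "v \<in> {-1..1}" "u \<le> v" for u v
  proof -
    have "ennreal \<bar>f v - f u\<bar> \<le> (\<integral>\<^sup>+s. ennreal \<bar>f' s\<bar> * indicator {u..v} s \<partial>lborel)"
      using that by (intro abs_increment_le_nn_integral f continuous_on_subset[OF f']) auto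
    also have "\<dots> \<le> B"
      unfolding B_def using that by (intro nn_integral_mono mult_left_mono) (auto simp: indicator_def)
    finally show ?thesis .
  qed
  have pt: "ennreal \<bar>f x\<bar> \<le> ennreal \<bar>f s\<bar> + B" if "s \<in> {-1..1}" for s
  proof -
    have "ennreal \<bar>f x\<bar> \<le> ennreal (\<bar>f s\<bar> + \<bar>f x - f s\<bar>)"
      by (intro ennreal_leI) linarith
    also have "\<dots> = ennreal \<bar>f s\<bar> + ennreal \<bar>f x - f s\<bar>"
      by simp
    also have "ennreal \<bar>f x - f s\<bar> \<le> B"
      using incr[of s x] incr[of x s] that x by (cases "s \<le> x") (auto simp: abs_minus_commute)
    finally show ?thesis
      by (simp add: add_left_mono)
  qed
  have two: "(\<integral>\<^sup>+s. c * indicator {-1..1::real} s \<partial>lborel) = 2 * c" for c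
    by (simp add: nn_integral_cmult_indicator mult.commute)
  have "2 * ennreal \<bar>f x\<bar> = (\<integral>\<^sup>+s. ennreal \<bar>f x\<bar> * indicator {-1..1::real} s \<partial>lborel)"
    by (simp add: two)
  also have "\<dots> \<le> (\<integral>\<^sup>+s. ennreal \<bar>f s\<bar> * indicator {-1..1} s + B * indicator {-1..1} s \<partial>lborel)"
    using pt by (intro nn_integral_mono) (auto simp: indicator_def)
  also have "\<dots> = (\<integral>\<^sup>+s. ennreal \<bar>f s\<bar> * indicator {-1..1} s \<partial>lborel) + 2 * B"
    by (simp add: nn_integral_add two)
  also have "\<dots> \<le> 2 * ((\<integral>\<^sup>+s. ennreal \<bar>f s\<bar> * indicator {-1..1} s \<partial>lborel) + B)"
    by (simp add: distrib_left mult_2)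
  also have "(\<integral>\<^sup>+s. ennreal \<bar>f s\<bar> * indicator {-1..1} s \<partial>lborel) + B
      = (\<integral>\<^sup>+s. ennreal (\<bar>f s\<bar> + \<bar>f' s\<bar>) * indicator {-1..1} s \<partial>lborel)"
    unfolding B_def
    by (subst nn_integral_add[symmetric]) (auto simp: distrib_right intro!: nn_integral_cong)
  finally show ?thesis
    by (simp add: ennreal_mult_le_mult_iff)
qed

section \<open>Functions on cubes spanned by coordinate directions\<close>

interpretation lborel_product: product_sigma_finite "\<lambda>_. lborel :: real measure" ..

definition cube :: "'i set \<Rightarrow> ('i \<Rightarrow> real) set" where
  "cube I = (\<Pi>\<^sub>E i\<in>I. {-1..1})"

text \<open>
  The density keeps the sigma-algebra of the full product, so that measurability does not change when
  the integration is restricted to the cube.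
\<close>

definition cube_measure :: "'i set \<Rightarrow> ('i \<Rightarrow> real) measure" where
  "cube_measure I = density (\<Pi>\<^sub>M i\<in>I. lborel) (indicator (cube I))"

text \<open>
  A parametrization of the affine subspace through \<open>a\<close> in the coordinate directions \<open>I\<close>. With
  \<open>a = \<plusminus>b\<close> and \<open>I = Basis - {b}\<close> the image of the cube is a face of the cube \<open>[-1, 1]\<^sup>N\<close>.
\<close>

definition slice_point :: "'a::euclidean_space \<Rightarrow> 'a set \<Rightarrow> ('a \<Rightarrow> real) \<Rightarrow> 'a" where
  "slice_point a I y = a + (\<Sum>c\<in>I. y c *\<^sub>R c)"

lemma sets_cube_measure [measurable_cong, simp]: "sets (cube_measure I) = sets (\<Pi>\<^sub>M i\<in>I. lborel)"
  by (simp add: cube_measure_def)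

lemma cube_sets [measurable]: "finite I \<Longrightarrow> cube I \<in> sets (\<Pi>\<^sub>M i\<in>I. lborel)"
  unfolding cube_def by (intro sets_PiM_I_finite) auto

lemma nn_integral_cube_measure:
  assumes "finite I" "f \<in> borel_measurable (\<Pi>\<^sub>M i\<in>I. lborel)"
  shows "(\<integral>\<^sup>+y. f y \<partial>cube_measure I) = (\<integral>\<^sup>+y. f y * indicator (cube I) y \<partial>(\<Pi>\<^sub>M i\<in>I. lborel))"
  unfolding cube_measure_def using assms
  by (subst nn_integral_density) (auto simp: mult.commute)

lemma AE_cube_measure: "finite I \<Longrightarrow> AE y in cube_measure I. y \<in> cube I"
  unfolding cube_measure_def by (subst AE_density) (auto split: split_indicator)

lemma nn_integral_cube_mono:
  assumes "finite I" "\<And>y. y \<in> cube I \<Longrightarrow> f y \<le> g y"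
  shows "(\<integral>\<^sup>+y. f y \<partial>cube_measure I) \<le> (\<integral>\<^sup>+y. g y \<partial>cube_measure I)"
  using AE_cube_measure[OF assms(1)] assms(2) by (intro nn_integral_mono_AE) auto

lemma emeasure_cube_measure_space:
  assumes "finite I"
  shows "emeasure (cube_measure I) (space (cube_measure I)) = 2 ^ card I"
proof -
  have "emeasure (cube_measure I) (space (cube_measure I)) = (\<integral>\<^sup>+y. 1 \<partial>cube_measure I)"
    by simp
  also have "\<dots> = emeasure (\<Pi>\<^sub>M i\<in>I. lborel) (cube I)"
    using assms by (subst nn_integral_cube_measure) auto
  also have "\<dots> = 2 ^ card I"
    unfolding cube_def using assms by (subst lborel_product.emeasure_PiM) auto
  finally show ?thesis .
qed

lemma measurable_slice_point [measurable]:
  "finite I \<Longrightarrow> slice_point a I \<in> borel_measurable (\<Pi>\<^sub>M i\<in>I. lborel)"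
  unfolding slice_point_def[abs_def] by measurable

lemma slice_point_upd:
  assumes "finite I" "j \<in> I"
  shows "slice_point a I (y(j := s)) = slice_point a I y + (s - y j) *\<^sub>R j"
proof -
  have "(\<Sum>c\<in>I - {j}. (y(j := s)) c *\<^sub>R c) = (\<Sum>c\<in>I - {j}. y c *\<^sub>R c)"
    by (intro sum.cong) auto
  then show ?thesis
    using assms by (simp add: slice_point_def sum.remove[OF assms] algebra_simps)
qed

lemma cube_upd_iff:
  assumes "y \<in> cube I" "j \<in> I"
  shows "y(j := s) \<in> cube I \<longleftrightarrow> s \<in> {-1..1}"
  using assms by (auto simp: cube_def PiE_def Pi_def extensional_def split: if_splits)

text \<open>
  The gradient is a parameter, so that gradients of rescaled functions can be written down directly.
\<close>

definition has_continuous_gradient :: "('a::euclidean_space \<Rightarrow> real) \<Rightarrow> ('a \<Rightarrow> 'a) \<Rightarrow> bool" where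
  "has_continuous_gradient w G \<longleftrightarrow>
     (\<forall>x. (w has_derivative (\<lambda>h. G x \<bullet> h)) (at x)) \<and> continuous_on UNIV G"

lemma has_continuous_gradientD:
  assumes "has_continuous_gradient w G"
  shows "(w has_derivative (\<lambda>h. G x \<bullet> h)) (at x)" "continuous_on UNIV G" "continuous_on UNIV w"
proof -
  show "(w has_derivative (\<lambda>h. G x \<bullet> h)) (at x)" "continuous_on UNIV G" for x
    using assms by (auto simp: has_continuous_gradient_def)
  then show "continuous_on UNIV w"
    by (meson differentiable_at_withinI differentiable_def differentiable_imp_continuous_on differentiable_on_def)
qed

lemma has_continuous_gradient_line:
  assumes "has_continuous_gradient w G"
  shows "((\<lambda>s. w (x + s *\<^sub>R v)) has_real_derivative (G (x + s *\<^sub>R v) \<bullet> v)) (at s)"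
proof -
  have "((\<lambda>s. x + s *\<^sub>R v) has_derivative (\<lambda>h. h *\<^sub>R v)) (at s)"
    by (auto intro!: derivative_eq_intros)
  from has_derivative_compose[OF this has_continuous_gradientD(1)[OF assms]]
  show ?thesis
    by (simp add: has_field_derivative_def mult_commute_abs inner_commute mult.commute)
qed

section \<open>The Sobolev inequality on a cube\<close>

lemma has_real_derivative_abs_powr:
  fixes s :: real
  assumes "1 < s"
  shows "((\<lambda>x. \<bar>x\<bar> powr s) has_real_derivative
      (s * (max x 0 powr (s - 1) - max (- x) 0 powr (s - 1)))) (at x)"
proof -
  consider "0 < x" | "x < 0" | "x = 0"
    by linarith
  then show ?thesis
  proof cases
    case 1
    have "((\<lambda>x. x powr s) has_real_derivative (s * x powr (s - 1))) (at x)"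
      using 1 by (auto intro!: derivative_eq_intros simp: powr_diff)
    then have "((\<lambda>x. \<bar>x\<bar> powr s) has_real_derivative (s * x powr (s - 1))) (at x)"
      by (rule has_field_derivative_transform_within_open[of _ _ _ "{0<..}"]) (use 1 in auto)
    then show ?thesis
      using 1 by (simp add: max_def)
  next
    case 2
    have "((\<lambda>x. (- x) powr s) has_real_derivative - (s * (- x) powr (s - 1))) (at x)"
      using 2 by (auto intro!: derivative_eq_intros simp: powr_diff)
    then have "((\<lambda>x. \<bar>x\<bar> powr s) has_real_derivative - (s * (- x) powr (s - 1))) (at x)"
      by (rule has_field_derivative_transform_within_open[of _ _ _ "{..<0}"]) (use 2 in auto)
    then show ?thesis
      using 2 by (simp add: max_def)
  next
    case 3
    have "((\<lambda>h. \<bar>h\<bar> powr s / h) \<longlongrightarrow> 0) (at (0::real))"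
    proof (rule Lim_null_comparison)
      show "\<forall>\<^sub>F h in at (0::real). norm (\<bar>h\<bar> powr s / h) \<le> \<bar>h\<bar> powr (s - 1)"
        by (intro always_eventually) (auto simp: powr_diff)
      show "((\<lambda>h. \<bar>h\<bar> powr (s - 1)) \<longlongrightarrow> 0) (at (0::real))"
        using assms by (intro tendsto_zero_powrI tendsto_rabs_zero tendsto_const) auto
    qed
    then show ?thesis
      using 3 by (simp add: DERIV_def)
  qed
qed

text \<open>
  \<open>abs_le_nn_integral_Icc\<close> applied to \<open>|f|\<^sup>s\<close>, whose derivative is at most \<open>s |f|\<^sup>s\<^sup>-\<^sup>1 |f'|\<close> in
  absolute value.
\<close>

lemma powr_abs_le_nn_integral_Icc:
  fixes f f' :: "real \<Rightarrow> real"
  assumes s: "1 < s" and x: "x \<in> {-1..1}"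
    and f: "\<And>r. r \<in> {-1..1} \<Longrightarrow> (f has_real_derivative f' r) (at r)"
    and f': "continuous_on {-1..1} f'"
    and d: "\<And>r. r \<in> {-1..1} \<Longrightarrow> \<bar>f r\<bar> + \<bar>f' r\<bar> \<le> d r"
  shows "ennreal \<bar>f x\<bar> epowr s
    \<le> (\<integral>\<^sup>+r. ennreal s * (ennreal \<bar>f r\<bar> epowr (s - 1)) * ennreal (d r) * indicator {-1..1} r \<partial>lborel)"
proof -
  \<comment> \<open>The derivative \<open>s |x|\<^sup>s\<^sup>-\<^sup>1 sgn x\<close>, written so that its continuity at \<open>0\<close> is evident.\<close>
  let ?\<phi> = "\<lambda>x. s * (max x 0 powr (s - 1) - max (- x) 0 powr (s - 1))"
  have contf: "continuous_on {-1..1} f"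
    using f by (meson DERIV_continuous_on has_field_derivative_at_within)
  have deriv: "((\<lambda>r. \<bar>f r\<bar> powr s) has_real_derivative (?\<phi> (f r) * f' r)) (at r)" if "r \<in> {-1..1}" for r
    using DERIV_chain2[OF has_real_derivative_abs_powr[OF s] f[OF that]] .
  have cont: "continuous_on {-1..1} (\<lambda>r. ?\<phi> (f r) * f' r)"
    using contf f' s by (intro continuous_intros continuous_on_powr') auto
  have "ennreal \<bar>f x\<bar> epowr s = ennreal \<bar>\<bar>f x\<bar> powr s\<bar>"
    by (simp add: ennreal_epowr)
  also have "\<dots> \<le> (\<integral>\<^sup>+r. ennreal (\<bar>\<bar>f r\<bar> powr s\<bar> + \<bar>?\<phi> (f r) * f' r\<bar>) * indicator {-1..1} r \<partial>lborel)"
    by (rule abs_le_nn_integral_Icc[OF x deriv cont])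
  also have "\<dots> \<le> (\<integral>\<^sup>+r. ennreal s * (ennreal \<bar>f r\<bar> epowr (s - 1)) * ennreal (d r) * indicator {-1..1} r \<partial>lborel)"
  proof (intro nn_integral_mono)
    fix r :: real
    show "ennreal (\<bar>\<bar>f r\<bar> powr s\<bar> + \<bar>?\<phi> (f r) * f' r\<bar>) * indicator {-1..1} r
      \<le> ennreal s * (ennreal \<bar>f r\<bar> epowr (s - 1)) * ennreal (d r) * indicator {-1..1} r"
    proof (cases "r \<in> {-1..1}")
      case True
      let ?P = "\<bar>f r\<bar> powr (s - 1)"
      have "\<bar>?\<phi> (f r)\<bar> = s * ?P"
        using s by (cases "f r" "0::real" rule: linorder_cases) (auto simp: abs_mult max_def)
      moreover have "\<bar>f r\<bar> powr s = ?P * \<bar>f r\<bar>"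
        by (cases "f r = 0") (auto simp: powr_diff)
      ultimately have "\<bar>\<bar>f r\<bar> powr s\<bar> + \<bar>?\<phi> (f r) * f' r\<bar> = ?P * \<bar>f r\<bar> + s * ?P * \<bar>f' r\<bar>"
        by (simp add: abs_mult)
      also have "?P * \<bar>f r\<bar> \<le> s * ?P * \<bar>f r\<bar>"
        using s mult_right_mono[of 1 s "?P * \<bar>f r\<bar>"] by (simp add: mult.assoc)
      also have "s * ?P * \<bar>f r\<bar> + s * ?P * \<bar>f' r\<bar> = s * ?P * (\<bar>f r\<bar> + \<bar>f' r\<bar>)"
        by (simp add: distrib_left)
      also have "\<dots> \<le> s * ?P * d r"
        using s d[OF True] by (intro mult_left_mono) auto
      finally have "ennreal (\<bar>\<bar>f r\<bar> powr s\<bar> + \<bar>?\<phi> (f r) * f' r\<bar>) \<le> ennreal (s * ?P * d r)"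
        by (intro ennreal_leI) simp
      also have "\<dots> = ennreal s * (ennreal \<bar>f r\<bar> epowr (s - 1)) * ennreal (d r)"
        using s order_trans[OF _ d[OF True], of 0] by (simp add: ennreal_epowr ennreal_mult)
      finally show ?thesis
        by (intro mult_right_mono) auto
    qed simp
  qed
  finally show ?thesis .
qed

lemma slice_point_cube_bound:
  assumes "finite I" "I \<subseteq> Basis" "y \<in> cube I"
  shows "norm (slice_point a I y) \<le> norm a + real (card I)"
proof -
  have "norm (slice_point a I y) \<le> norm a + (\<Sum>c\<in>I. norm (y c *\<^sub>R c))"
    unfolding slice_point_def by (intro order_trans[OF norm_triangle_ineq] add_left_mono norm_sum)
  also have "(\<Sum>c\<in>I. norm (y c *\<^sub>R c)) \<le> (\<Sum>c\<in>I. 1)"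
    using assms by (intro sum_mono) (auto simp: cube_def PiE_def Pi_def abs_le_iff norm_Basis subset_iff)
  finally show ?thesis
    by simp
qed

lemma nn_integral_cube_slice_finite:
  fixes F :: "'a::euclidean_space \<Rightarrow> real"
  assumes I: "finite I" "I \<subseteq> Basis" and F: "continuous_on UNIV F" and r: "0 \<le> r"
  shows "(\<integral>\<^sup>+y. ennreal (F (slice_point a I y)) epowr r \<partial>cube_measure I) < top"
proof -
  let ?K = "cball (0::'a) (norm a + real (card I))"
  have "compact (F ` ?K)"
    by (intro compact_continuous_image continuous_on_subset[OF F]) auto
  then obtain B where B: "\<And>x. x \<in> ?K \<Longrightarrow> F x \<le> B"
    by (meson bounded_imp_bdd_above bdd_above.E compact_imp_bounded imageI)
  have "(\<integral>\<^sup>+y. ennreal (F (slice_point a I y)) epowr r \<partial>cube_measure I)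
      \<le> (\<integral>\<^sup>+y. ennreal B epowr r \<partial>cube_measure I)"
    using I r slice_point_cube_bound[OF I, of _ a]
    by (intro nn_integral_cube_mono epowr_mono ennreal_leI B) auto
  also have "\<dots> = ennreal B epowr r * 2 ^ card I"
    using I by (simp add: emeasure_cube_measure_space)
  also have "\<dots> < top"
    by (auto simp: ennreal_mult_less_top power_less_top_ennreal ennreal_mult_eq_top_iff
        power_eq_top_ennreal less_top[symmetric])
  finally show ?thesis .
qed

text \<open>
  The exponent \<open>s\<close> is chosen so that, with \<open>M = card I\<close>, both \<open>s M / (M - 1) = r\<close> and
  \<open>(s - 1) p / (p - 1) = r\<close>. By the first equation, \<open>Gagliardo\<close> applied to the coordinate-line bounds of
  \<open>|w|\<^sup>s\<close> estimates \<open>\<integral> |w|\<^sup>r\<close> by a power of \<open>\<integral> |w|\<^sup>s\<^sup>-\<^sup>1 (|w| + |G|)\<close>; by the second one, the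
  Hoelder inequality turns the latter into \<open>(\<integral> |w|\<^sup>r)\<^bsup>1 - 1/p\<^esup>\<close> times the desired norm. The power of
  \<open>\<integral> |w|\<^sup>r\<close> on the right is smaller than that on the left and can be cancelled.
\<close>

theorem Sobolev_cube:
  fixes w :: "'a::euclidean_space \<Rightarrow> real"
  assumes wG: "has_continuous_gradient w G"
    and I: "I \<subseteq> Basis" "2 \<le> card I" and p: "1 < p" "p < real (card I)"
  defines "r \<equiv> p * real (card I) / (real (card I) - p)"
    and "s \<equiv> p * (real (card I) - 1) / (real (card I) - p)"
  shows "(\<integral>\<^sup>+y. ennreal \<bar>w (slice_point a I y)\<bar> epowr r \<partial>cube_measure I) epowr (p / r)
    \<le> ennreal (s powr p) *
      (\<integral>\<^sup>+y. ennreal (\<bar>w (slice_point a I y)\<bar> + norm (G (slice_point a I y))) epowr p \<partial>cube_measure I)"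
proof -
  define M where "M = real (card I)"
  have M: "2 \<le> M" "1 < p" "p < M" and fin: "finite I"
    using I p finite_subset[OF I(1)] by (auto simp: M_def)
  have r: "r = p * M / (M - p)" and s: "s = p * (M - 1) / (M - p)"
    by (simp_all add: r_def s_def M_def)
  have s1: "1 < s"
    using M by (simp add: s field_simps)
  have r0: "0 < r"
    using M by (simp add: r)
  let ?P = "\<Pi>\<^sub>M i\<in>I. lborel :: real measure"
  define W where "W y = ennreal \<bar>w (slice_point a I y)\<bar>" for y
  define E where "E y = ennreal (\<bar>w (slice_point a I y)\<bar> + norm (G (slice_point a I y)))" for y
  have [measurable]: "w \<in> borel_measurable borel" "G \<in> borel_measurable borel"
    using has_continuous_gradientD(2,3)[OF wG] by (auto intro: borel_measurable_continuous_onI)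
  note [measurable] = measurable_slice_point[OF fin] cube_sets[OF fin]
  have W [measurable]: "W \<in> borel_measurable ?P" and E [measurable]: "E \<in> borel_measurable ?P"
    unfolding W_def[abs_def] E_def[abs_def] by measurable
  define A where "A = (\<integral>\<^sup>+y. W y epowr r \<partial>cube_measure I)"
  define B where "B = (\<integral>\<^sup>+y. E y epowr p \<partial>cube_measure I)"
  define h where "h y = ennreal s * W y epowr (s - 1) * E y * indicator (cube I) y" for y
  have h [measurable]: "h \<in> borel_measurable ?P"
    unfolding h_def[abs_def] by measurable
  have line: "W y epowr s \<le> (\<integral>\<^sup>+t. h (y(j := t)) \<partial>lborel)" if y: "y \<in> cube I" and j: "j \<in> I" for y j
  proof -
    define z where "z = slice_point a I y - y j *\<^sub>R j"
    have z: "slice_point a I (y(j := t)) = z + t *\<^sub>R j" for t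
      using slice_point_upd[OF fin j] by (simp add: z_def algebra_simps)
    have "norm j = 1" "y j \<in> {-1..1}"
      using I j y by (auto simp: cube_def)
    have "ennreal \<bar>w (z + y j *\<^sub>R j)\<bar> epowr s
        \<le> (\<integral>\<^sup>+t. ennreal s * (ennreal \<bar>w (z + t *\<^sub>R j)\<bar> epowr (s - 1))
            * ennreal (\<bar>w (z + t *\<^sub>R j)\<bar> + norm (G (z + t *\<^sub>R j))) * indicator {-1..1} t \<partial>lborel)"
    proof (rule powr_abs_le_nn_integral_Icc[OF s1 \<open>y j \<in> {-1..1}\<close>])
      show "((\<lambda>t. w (z + t *\<^sub>R j)) has_real_derivative (G (z + t *\<^sub>R j) \<bullet> j)) (at t)" for t
        by (rule has_continuous_gradient_line[OF wG])
      show "continuous_on {-1..1} (\<lambda>t. G (z + t *\<^sub>R j) \<bullet> j)"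
        by (intro continuous_intros continuous_on_compose2[OF has_continuous_gradientD(2)[OF wG]]) auto
      show "\<bar>w (z + t *\<^sub>R j)\<bar> + \<bar>G (z + t *\<^sub>R j) \<bullet> j\<bar> \<le> \<bar>w (z + t *\<^sub>R j)\<bar> + norm (G (z + t *\<^sub>R j))" for t
        using Cauchy_Schwarz_ineq2[of "G (z + t *\<^sub>R j)" j] \<open>norm j = 1\<close> by simp
    qed
    also have "\<dots> = (\<integral>\<^sup>+t. h (y(j := t)) \<partial>lborel)"
      by (intro nn_integral_cong)
         (auto simp: h_def W_def E_def z cube_upd_iff[OF y j] split: split_indicator)
    finally show ?thesis
      by (simp add: W_def z_def)
  qed
  have "A = (\<integral>\<^sup>+y. W y epowr r * indicator (cube I) y \<partial>?P)"
    unfolding A_def by (intro nn_integral_cube_measure fin) measurable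
  also have "\<dots> \<le> (\<integral>\<^sup>+y. (\<Prod>j\<in>I. (\<integral>\<^sup>+t. h (y(j := t)) \<partial>lborel) epowr (1 / (real (card I) - 1))) \<partial>?P)"
  proof (intro nn_integral_mono)
    fix y
    show "W y epowr r * indicator (cube I) y
        \<le> (\<Prod>j\<in>I. (\<integral>\<^sup>+t. h (y(j := t)) \<partial>lborel) epowr (1 / (real (card I) - 1)))"
    proof (cases "y \<in> cube I")
      case True
      have "(\<Prod>j\<in>I. (W y epowr s) epowr (1 / (real (card I) - 1)))
          \<le> (\<Prod>j\<in>I. (\<integral>\<^sup>+t. h (y(j := t)) \<partial>lborel) epowr (1 / (real (card I) - 1)))"
        using I by (intro prod_mono_ennreal epowr_mono line True) auto
      moreover have "(\<Prod>j\<in>I. (W y epowr s) epowr (1 / (real (card I) - 1))) = W y epowr r"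
      proof -
        have "real (card I) * (s * (1 / (real (card I) - 1))) = r"
          using M by (simp add: r s flip: M_def)
        then show ?thesis
          using I by (simp only: epowr_epowr prod_constant) (simp add: epowr_power)
      qed
      ultimately show ?thesis
        using True by simp
    qed simp
  qed
  also have "\<dots> \<le> (\<Prod>j\<in>I. (\<integral>\<^sup>+y. h y \<partial>?P) epowr (1 / (real (card I) - 1)))"
    by (rule lborel_product.Gagliardo[OF fin I(2)]) (rule h)
  also have "\<dots> = (\<integral>\<^sup>+y. h y \<partial>?P) epowr (M / (M - 1))"
    using I by (simp add: epowr_power M_def)
  finally have "A epowr ((M - 1) / M) \<le> ((\<integral>\<^sup>+y. h y \<partial>?P) epowr (M / (M - 1))) epowr ((M - 1) / M)"
    using M by (intro epowr_mono) auto
  also have "\<dots> = (\<integral>\<^sup>+y. h y \<partial>?P)"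
    using M by (simp add: epowr_epowr)
  also have "\<dots> = (\<integral>\<^sup>+y. ennreal s * (W y epowr (s - 1) * E y) \<partial>cube_measure I)"
    by (subst nn_integral_cube_measure[OF fin]) (measurable, simp add: h_def[abs_def] mult_ac)
  also have "\<dots> = ennreal s * (\<integral>\<^sup>+y. (W y epowr r) epowr (1 - 1 / p) * (E y epowr p) epowr (1 / p) \<partial>cube_measure I)"
  proof -
    have "r * (1 - 1 / p) = s - 1" "p * (1 / p) = 1"
      using M by (simp_all add: r s field_simps)
    then show ?thesis
      unfolding epowr_epowr by (simp add: nn_integral_cmult)
  qed
  also have "\<dots> \<le> ennreal s * (A epowr (1 - 1 / p) * B epowr (1 / p))"
    unfolding A_def B_def using M by (intro mult_left_mono Hoelder) auto
  finally have main: "A epowr ((M - 1) / M) \<le> ennreal s * (A epowr (1 - 1 / p) * B epowr (1 / p))" .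
  have "A epowr (p / r) \<le> ennreal (s powr p) * B"
  proof (cases "A = 0")
    case False
    \<comment> \<open>Cancelling a power of \<open>A\<close> needs its finiteness, which holds as \<open>w\<close> is bounded on the cube.\<close>
    have "A < top"
      unfolding A_def W_def using r0 has_continuous_gradientD(3)[OF wG]
      by (intro nn_integral_cube_slice_finite fin I continuous_intros) auto
    have "1 / p - 1 / M + (1 - 1 / p) = (M - 1) / M"
      using M by (simp add: field_simps)
    then have "A epowr (1 - 1 / p) * A epowr (1 / p - 1 / M)
        \<le> A epowr (1 - 1 / p) * (ennreal s * B epowr (1 / p))"
      using main by (simp add: epowr_add mult_ac add_ac)
    then have "A epowr (1 / p - 1 / M) \<le> ennreal s * B epowr (1 / p)"
      using False \<open>A < top\<close> by (subst (asm) ennreal_mult_le_mult_iff) auto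
    then have "(A epowr (1 / p - 1 / M)) epowr p \<le> (ennreal s * B epowr (1 / p)) epowr p"
      using M by (intro epowr_mono) auto
    moreover have "(1 / p - 1 / M) * p = p / r"
      using M by (simp add: r field_simps)
    ultimately show ?thesis
      using M s1 by (simp add: epowr_mult epowr_epowr ennreal_epowr)
  qed simp
  then show ?thesis
    by (simp add: A_def B_def W_def E_def)
qed

section \<open>The Morrey inequality on a cube\<close>

lemma nn_integral_PiM_lborel_affine:
  fixes c :: "'i \<Rightarrow> real"
  assumes "finite I" "f \<in> borel_measurable (\<Pi>\<^sub>M i\<in>I. lborel)" "t \<noteq> 0"
  shows "(\<integral>\<^sup>+y. f y \<partial>(\<Pi>\<^sub>M i\<in>I. lborel))
    = ennreal (\<bar>t\<bar> ^ card I) * (\<integral>\<^sup>+y. f (\<lambda>i\<in>I. c i + t * y i) \<partial>(\<Pi>\<^sub>M i\<in>I. lborel))"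
  using assms(1,2)
proof (induction I arbitrary: f)
  case empty
  then show ?case
    by (subst (1 2) lborel_product.nn_integral_empty) (simp_all add: restrict_def)
next
  case (insert a I)
  note f [measurable] = insert.prems
  let ?P = "\<lambda>I. \<Pi>\<^sub>M i\<in>I. lborel :: real measure"
  let ?T = "\<lambda>I y. \<lambda>i\<in>I. c i + t * y i"
  have T [measurable]: "?T J \<in> ?P J \<rightarrow>\<^sub>M ?P J" for J
    by measurable
  have upd [measurable]: "(\<lambda>y. y(a := s)) \<in> ?P I \<rightarrow>\<^sub>M ?P (insert a I)" for s
    by (intro measurable_fun_upd[where J=I]) auto
  have eq: "(?T I y)(a := c a + t * s) = ?T (insert a I) (y(a := s))" for y s
    using insert.hyps by (auto simp: restrict_def)
  have upd2: "(\<lambda>(s, y). y(a := s)) \<in> lborel \<Otimes>\<^sub>M ?P I \<rightarrow>\<^sub>M ?P (insert a I)"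
    by measurable
  have meas: "(\<lambda>s. \<integral>\<^sup>+y. f ((?T I y)(a := s)) \<partial>?P I) \<in> borel_measurable borel"
  proof -
    interpret I: finite_product_sigma_finite "\<lambda>_. lborel :: real measure" I
      by standard (rule insert.hyps)
    have "(\<lambda>s. \<integral>\<^sup>+y. f ((?T I y)(a := s)) \<partial>?P I) \<in> borel_measurable lborel"
      by (rule I.borel_measurable_nn_integral) measurable
    then show ?thesis
      by simp
  qed
  have "(\<integral>\<^sup>+y. f y \<partial>?P (insert a I)) = (\<integral>\<^sup>+s. \<integral>\<^sup>+y. f (y(a := s)) \<partial>?P I \<partial>lborel)"
    by (rule lborel_product.product_nn_integral_insert_rev) (use insert in auto)
  also have "\<dots> = (\<integral>\<^sup>+s. ennreal (\<bar>t\<bar> ^ card I) * (\<integral>\<^sup>+y. f ((?T I y)(a := s)) \<partial>?P I) \<partial>lborel)"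
    by (intro nn_integral_cong insert.IH) measurable
  also have "\<dots> = ennreal (\<bar>t\<bar> ^ card I) * (\<integral>\<^sup>+s. (\<integral>\<^sup>+y. f ((?T I y)(a := s)) \<partial>?P I) \<partial>lborel)"
    using meas by (intro nn_integral_cmult) simp
  also have "(\<integral>\<^sup>+s. (\<integral>\<^sup>+y. f ((?T I y)(a := s)) \<partial>?P I) \<partial>lborel)
      = ennreal \<bar>t\<bar> * (\<integral>\<^sup>+s. (\<integral>\<^sup>+y. f ((?T I y)(a := c a + t * s)) \<partial>?P I) \<partial>lborel)"
    by (rule nn_integral_real_affine[OF meas \<open>t \<noteq> 0\<close>])
  also have "(\<integral>\<^sup>+s. (\<integral>\<^sup>+y. f ((?T I y)(a := c a + t * s)) \<partial>?P I) \<partial>lborel)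
      = (\<integral>\<^sup>+y. f (?T (insert a I) y) \<partial>?P (insert a I))"
    unfolding eq
    by (rule lborel_product.product_nn_integral_insert_rev[symmetric]) (use insert in auto)
  also have "ennreal (\<bar>t\<bar> ^ card I) * (ennreal \<bar>t\<bar> * \<dots>)
      = ennreal (\<bar>t\<bar> ^ card (insert a I)) * (\<integral>\<^sup>+y. f (?T (insert a I) y) \<partial>?P (insert a I))"
    using insert.hyps by (simp add: ennreal_mult mult_ac)
  finally show ?case .
qed

lemma slice_point_segment:
  "slice_point a I (\<lambda>i\<in>I. x i + s * (y i - x i))
    = slice_point a I x + s *\<^sub>R (slice_point a I y - slice_point a I x)"
  by (simp add: slice_point_def algebra_simps sum.distrib sum_subtractf scaleR_sum_right)

lemma cube_segment:
  assumes "x \<in> cube I" "y \<in> cube I" "0 \<le> s" "s \<le> 1"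
  shows "(\<lambda>i\<in>I. x i + s * (y i - x i)) \<in> cube I"
proof -
  have "x i + s * (y i - x i) \<in> {-1..1}" if "i \<in> I" for i
  proof -
    have xy: "x i \<in> {-1..1}" "y i \<in> {-1..1}"
      using assms that by (auto simp: cube_def)
    have "(1 - s) *\<^sub>R x i + s *\<^sub>R y i \<in> {-1..1}"
      using assms xy by (intro convexD[OF convex_real_interval(5)]) auto
    then show ?thesis
      by (simp add: algebra_simps)
  qed
  then show ?thesis
    by (auto simp: cube_def)
qed

lemma slice_point_cube_dist:
  assumes "finite I" "I \<subseteq> Basis" "x \<in> cube I" "y \<in> cube I"
  shows "norm (slice_point a I y - slice_point a I x) \<le> 2 * real (card I)"
proof -
  have "slice_point a I y - slice_point a I x = (\<Sum>c\<in>I. (y c - x c) *\<^sub>R c)"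
    by (simp add: slice_point_def scaleR_diff_left sum_subtractf)
  also have "norm \<dots> \<le> (\<Sum>c\<in>I. norm ((y c - x c) *\<^sub>R c))"
    by (rule norm_sum)
  also have "\<dots> \<le> (\<Sum>c\<in>I. 2)"
  proof (rule sum_mono)
    fix c assume "c \<in> I"
    then have "x c \<in> {-1..1}" "y c \<in> {-1..1}" "norm c = 1"
      using assms by (auto simp: cube_def)
    then show "norm ((y c - x c) *\<^sub>R c) \<le> 2"
      by (auto simp: abs_le_iff)
  qed
  finally show ?thesis
    by simp
qed

text \<open>
  Moving \<open>y\<close> towards \<open>x\<close> by the factor \<open>s\<close> maps the cube into itself and multiplies volumes by
  \<open>s\<^bsup>card I\<^esup>\<close>. This power of \<open>s\<close> enters the \<open>p\<close>-th power of the norm on the image, so only its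
  \<open>p\<close>-th root is lost.
\<close>

lemma nn_integral_cube_segment_le:
  fixes D :: "'a::euclidean_space \<Rightarrow> ennreal"
  assumes I: "finite I" and D [measurable]: "D \<in> borel_measurable borel"
    and x: "x \<in> cube I" and s: "0 < s" "s \<le> 1" and p: "1 < p"
  shows "(\<integral>\<^sup>+y. D (slice_point a I x + s *\<^sub>R (slice_point a I y - slice_point a I x)) \<partial>cube_measure I)
    \<le> ennreal (s powr (- real (card I) / p)) * 2 ^ card I
        * (\<integral>\<^sup>+y. D (slice_point a I y) epowr p \<partial>cube_measure I) epowr (1 / p)"
proof -
  let ?P = "\<Pi>\<^sub>M i\<in>I. lborel :: real measure"
  let ?S = "\<lambda>y. \<lambda>i\<in>I. x i + s * (y i - x i)"
  let ?B = "\<integral>\<^sup>+y. D (slice_point a I y) epowr p \<partial>cube_measure I"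
  note [measurable] = measurable_slice_point[OF I] cube_sets[OF I]
  have "(\<integral>\<^sup>+y. D (slice_point a I (?S y)) epowr p \<partial>cube_measure I)
      = (\<integral>\<^sup>+y. D (slice_point a I (?S y)) epowr p * indicator (cube I) y \<partial>?P)"
    by (intro nn_integral_cube_measure I) measurable
  also have "\<dots> \<le> (\<integral>\<^sup>+y. D (slice_point a I (?S y)) epowr p * indicator (cube I) (?S y) \<partial>?P)"
    using cube_segment[OF x] s by (intro nn_integral_mono mult_left_mono) (auto split: split_indicator)
  also have "\<dots> = ennreal (s powr - real (card I)) *
      (ennreal (\<bar>s\<bar> ^ card I) * (\<integral>\<^sup>+y. D (slice_point a I (?S y)) epowr p * indicator (cube I) (?S y) \<partial>?P))"
    using s by (simp add: powr_minus powr_realpow flip: mult.assoc ennreal_mult)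
  also have "ennreal (\<bar>s\<bar> ^ card I) * (\<integral>\<^sup>+y. D (slice_point a I (?S y)) epowr p * indicator (cube I) (?S y) \<partial>?P)
      = (\<integral>\<^sup>+y. D (slice_point a I y) epowr p * indicator (cube I) y \<partial>?P)"
    using nn_integral_PiM_lborel_affine[OF I, of "\<lambda>y. D (slice_point a I y) epowr p * indicator (cube I) y" s
        "\<lambda>i. (1 - s) * x i"] s
    by (simp add: algebra_simps)
  also have "\<dots> = ?B"
    by (intro nn_integral_cube_measure[symmetric] I) measurable
  finally have *: "(\<integral>\<^sup>+y. D (slice_point a I (?S y)) epowr p \<partial>cube_measure I)
      \<le> ennreal (s powr - real (card I)) * ?B" .
  have "(\<integral>\<^sup>+y. D (slice_point a I (?S y)) \<partial>cube_measure I)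
      = (\<integral>\<^sup>+y. (D (slice_point a I (?S y)) epowr p) epowr (1 / p) * 1 epowr (1 - 1 / p) \<partial>cube_measure I)"
    using p by (simp add: epowr_epowr)
  also have "\<dots> \<le> (\<integral>\<^sup>+y. D (slice_point a I (?S y)) epowr p \<partial>cube_measure I) epowr (1 / p)
      * (\<integral>\<^sup>+y. 1 \<partial>cube_measure I) epowr (1 - 1 / p)"
    using p by (intro Hoelder) auto
  also have "\<dots> \<le> (ennreal (s powr - real (card I)) * ?B) epowr (1 / p) * 2 ^ card I"
  proof (intro mult_mono epowr_mono *)
    have "(2 ^ card I) epowr (1 - 1 / p) = ennreal ((2 ^ card I) powr (1 - 1 / p))"
      using ennreal_epowr[of "2 ^ card I" "1 - 1 / p"] by (simp add: ennreal_power[symmetric])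
    also have "\<dots> \<le> ennreal ((2 ^ card I) powr 1)"
      using p by (intro ennreal_leI powr_mono) auto
    finally show "(\<integral>\<^sup>+y. 1 \<partial>cube_measure I) epowr (1 - 1 / p) \<le> 2 ^ card I"
      using emeasure_cube_measure_space[OF I] by (simp add: ennreal_power[symmetric])
  qed (use p in auto)
  also have "\<dots> = ennreal (s powr (- real (card I) / p)) * 2 ^ card I * ?B epowr (1 / p)"
    by (simp add: epowr_mult ennreal_epowr powr_powr mult_ac)
  finally show ?thesis
    unfolding slice_point_segment .
qed

text \<open>
  Integrating the gradient along the segments from \<open>x\<close> to all points of the cube and averaging,
  \<open>nn_integral_cube_segment_le\<close> gives the factor \<open>\<integral>\<^sub>0\<^sup>1 s\<^bsup>- card I / p\<^esup> ds\<close>, which is finite exactly for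
  \<open>card I < p\<close>.
\<close>

theorem Morrey_cube:
  fixes w :: "'a::euclidean_space \<Rightarrow> real"
  assumes wG: "has_continuous_gradient w G"
    and I: "I \<subseteq> Basis" and p: "1 < p" "real (card I) < p" and x: "x \<in> cube I"
  defines "c \<equiv> 1 + 2 * real (card I) * p / (p - real (card I))"
  shows "ennreal \<bar>w (slice_point a I x)\<bar> epowr p \<le> ennreal (c powr p) *
      (\<integral>\<^sup>+y. ennreal (\<bar>w (slice_point a I y)\<bar> + norm (G (slice_point a I y))) epowr p \<partial>cube_measure I)"
proof -
  have fin: "finite I"
    using finite_subset[OF I] by simp
  let ?M = "real (card I)"
  let ?e = "slice_point a I"
  define D where "D z = ennreal (\<bar>w z\<bar> + norm (G z))" for z
  have wG_meas [measurable]: "w \<in> borel_measurable borel" "G \<in> borel_measurable borel"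
    using has_continuous_gradientD(2,3)[OF wG] by (auto intro: borel_measurable_continuous_onI)
  have D [measurable]: "D \<in> borel_measurable borel"
    unfolding D_def[abs_def] by measurable
  note [measurable] = measurable_slice_point[OF fin] cube_sets[OF fin]
  define B where "B = (\<integral>\<^sup>+y. D (?e y) epowr p \<partial>cube_measure I)"
  let ?L = "\<lambda>y. \<integral>\<^sup>+s. D (?e x + s *\<^sub>R (?e y - ?e x)) * indicator {0..1} s \<partial>lborel"
  interpret C: finite_measure "cube_measure I"
    by standard (simp add: emeasure_cube_measure_space[OF fin] power_eq_top_ennreal)
  interpret CL: pair_sigma_finite lborel "cube_measure I" ..
  have pt: "ennreal \<bar>w (?e x)\<bar> \<le> D (?e y) + ennreal (2 * ?M) * ?L y" if y: "y \<in> cube I" for y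
  proof -
    let ?v = "?e y - ?e x"
    have "ennreal \<bar>w (?e x + 1 *\<^sub>R ?v) - w (?e x + 0 *\<^sub>R ?v)\<bar>
        \<le> (\<integral>\<^sup>+s. ennreal \<bar>G (?e x + s *\<^sub>R ?v) \<bullet> ?v\<bar> * indicator {0..1} s \<partial>lborel)"
      by (rule abs_increment_le_nn_integral)
         (auto intro!: has_continuous_gradient_line[OF wG] continuous_intros
            continuous_on_compose2[OF has_continuous_gradientD(2)[OF wG]])
    also have "\<dots> \<le> (\<integral>\<^sup>+s. ennreal (2 * ?M) * (D (?e x + s *\<^sub>R ?v) * indicator {0..1} s) \<partial>lborel)"
    proof (rule nn_integral_mono)
      fix s :: real
      have "\<bar>G (?e x + s *\<^sub>R ?v) \<bullet> ?v\<bar> \<le> norm (G (?e x + s *\<^sub>R ?v)) * norm ?v"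
        by (rule Cauchy_Schwarz_ineq2)
      also have "\<dots> \<le> (\<bar>w (?e x + s *\<^sub>R ?v)\<bar> + norm (G (?e x + s *\<^sub>R ?v))) * (2 * ?M)"
        by (intro mult_mono slice_point_cube_dist fin I x y) auto
      finally have "ennreal \<bar>G (?e x + s *\<^sub>R ?v) \<bullet> ?v\<bar> \<le> ennreal (2 * ?M) * D (?e x + s *\<^sub>R ?v)"
        unfolding D_def by (subst ennreal_mult[symmetric]) (auto simp: mult.commute intro!: ennreal_leI)
      then show "ennreal \<bar>G (?e x + s *\<^sub>R ?v) \<bullet> ?v\<bar> * indicator {0..1} s
          \<le> ennreal (2 * ?M) * (D (?e x + s *\<^sub>R ?v) * indicator {0..1} s)"
        by (simp add: mult_right_mono flip: mult.assoc)
    qed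
    also have "\<dots> = ennreal (2 * ?M) * ?L y"
      by (intro nn_integral_cmult) measurable
    finally have incr: "ennreal \<bar>w (?e y) - w (?e x)\<bar> \<le> ennreal (2 * ?M) * ?L y"
      by simp
    have "ennreal \<bar>w (?e x)\<bar> \<le> ennreal ((\<bar>w (?e y)\<bar> + norm (G (?e y))) + \<bar>w (?e y) - w (?e x)\<bar>)"
      by (intro ennreal_leI) (smt (verit) norm_ge_zero)
    also have "\<dots> = D (?e y) + ennreal \<bar>w (?e y) - w (?e x)\<bar>"
      by (simp add: D_def)
    finally show ?thesis
      using incr by (meson add_left_mono order_trans)
  qed
  have seg: "(\<integral>\<^sup>+y. D (?e x + s *\<^sub>R (?e y - ?e x)) \<partial>cube_measure I)
      \<le> ennreal (s powr (- ?M / p)) * 2 ^ card I * B epowr (1 / p)" if "0 < s" "s \<le> 1" for s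
    unfolding B_def by (rule nn_integral_cube_segment_le[OF fin D x that p(1)])
  have "(\<integral>\<^sup>+y. ?L y \<partial>cube_measure I)
      = (\<integral>\<^sup>+s. \<integral>\<^sup>+y. D (?e x + s *\<^sub>R (?e y - ?e x)) * indicator {0..1} s \<partial>cube_measure I \<partial>lborel)"
    by (rule CL.Fubini') measurable
  also have "\<dots> \<le> (\<integral>\<^sup>+s. (2 ^ card I * B epowr (1 / p)) * (ennreal (s powr (- ?M / p)) * indicator {0..1} s) \<partial>lborel)"
  proof (rule nn_integral_mono_AE)
    have "AE s in lborel. s \<noteq> (0::real)"
      by (rule AE_lborel_singleton)
    then show "AE s in lborel. (\<integral>\<^sup>+y. D (?e x + s *\<^sub>R (?e y - ?e x)) * indicator {0..1} s \<partial>cube_measure I)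
        \<le> (2 ^ card I * B epowr (1 / p)) * (ennreal (s powr (- ?M / p)) * indicator {0..1} s)"
    proof eventually_elim
      case (elim s)
      then show ?case
        using seg[of s] by (cases "s \<in> {0..1}") (auto simp: mult_ac)
    qed
  qed
  also have "\<dots> = (2 ^ card I * B epowr (1 / p)) * (\<integral>\<^sup>+s. ennreal (s powr (- ?M / p)) * indicator {0..1} s \<partial>lborel)"
    by (intro nn_integral_cmult) measurable
  also have "(\<integral>\<^sup>+s. ennreal (s powr (- ?M / p)) * indicator {0..1} s \<partial>lborel) = ennreal (p / (p - ?M))"
  proof -
    have "((\<lambda>s. s powr (- ?M / p)) has_integral (1 powr (- ?M / p + 1) / (- ?M / p + 1))) {0..1}"
      using p by (intro has_integral_powr_from_0) (auto simp: field_simps)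
    moreover have "1 powr (- ?M / p + 1) / (- ?M / p + 1) = p / (p - ?M)"
      using p by (simp add: field_simps)
    ultimately show ?thesis
      by (intro nn_integral_has_integral_lebesgue') auto
  qed
  finally have L: "(\<integral>\<^sup>+y. ?L y \<partial>cube_measure I) \<le> 2 ^ card I * B epowr (1 / p) * ennreal (p / (p - ?M))" .
  have "2 ^ card I * ennreal \<bar>w (?e x)\<bar> = (\<integral>\<^sup>+y. ennreal \<bar>w (?e x)\<bar> \<partial>cube_measure I)"
    using emeasure_cube_measure_space[OF fin] by (simp add: mult.commute)
  also have "\<dots> \<le> (\<integral>\<^sup>+y. D (?e y) + ennreal (2 * ?M) * ?L y \<partial>cube_measure I)"
    using fin pt by (rule nn_integral_cube_mono)
  also have "\<dots> = (\<integral>\<^sup>+y. D (?e y) \<partial>cube_measure I) + ennreal (2 * ?M) * (\<integral>\<^sup>+y. ?L y \<partial>cube_measure I)"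
  proof -
    have "(\<lambda>y. ?L y) \<in> borel_measurable (cube_measure I)"
      by measurable
    then show ?thesis
      by (simp add: nn_integral_add nn_integral_cmult)
  qed
  also have "\<dots> \<le> 2 ^ card I * B epowr (1 / p)
      + ennreal (2 * ?M) * (2 ^ card I * B epowr (1 / p) * ennreal (p / (p - ?M)))"
    using seg[of 1] L by (intro add_mono mult_left_mono) auto
  also have "\<dots> = 2 ^ card I * (ennreal c * B epowr (1 / p))"
  proof -
    have "ennreal c = 1 + ennreal (2 * ?M) * ennreal (p / (p - ?M))"
      unfolding c_def using p
      by (subst ennreal_mult[symmetric]) (auto simp flip: ennreal_plus ennreal_1)
    then show ?thesis
      by (simp add: distrib_left mult_ac)
  qed
  finally have "ennreal \<bar>w (?e x)\<bar> \<le> ennreal c * B epowr (1 / p)"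
    by (subst (asm) ennreal_mult_le_mult_iff) (auto simp: power_eq_top_ennreal)
  then have "ennreal \<bar>w (?e x)\<bar> epowr p \<le> (ennreal c * B epowr (1 / p)) epowr p"
    using p by (intro epowr_mono) auto
  also have "\<dots> = ennreal (c powr p) * B"
  proof -
    have "0 \<le> c"
      using p by (simp add: c_def)
    then show ?thesis
      using p by (simp add: epowr_mult epowr_epowr ennreal_epowr)
  qed
  finally show ?thesis
    by (simp add: B_def D_def)
qed

section \<open>The weighted inequality on a cube\<close>

text \<open>
  In the case \<open>p = n\<close>, every finite \<open>r\<close> above \<open>n\<close> is the critical exponent of some \<open>p' < n\<close>, and on a
  cube of finite volume the norm with exponent \<open>p'\<close> is bounded by that with exponent \<open>p\<close>.
\<close>

lemma Sobolev_cube_exponents: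
  fixes p r :: real and n :: nat
  assumes "1 < p" "2 \<le> n" and "p < n \<and> r = p * n / (n - p) \<or> p = n \<and> n < r"
  obtains K where "0 < K"
    "\<And>a I (w :: 'a::euclidean_space \<Rightarrow> real) G. I \<subseteq> Basis \<Longrightarrow> card I = n \<Longrightarrow> has_continuous_gradient w G \<Longrightarrow>
      (\<integral>\<^sup>+y. ennreal \<bar>w (slice_point a I y)\<bar> epowr r \<partial>cube_measure I) epowr (p / r) \<le> ennreal K *
      (\<integral>\<^sup>+y. ennreal (\<bar>w (slice_point a I y)\<bar> + norm (G (slice_point a I y))) epowr p \<partial>cube_measure I)"
proof -
  define M where "M = real n"
  have assms: "1 < p" "2 \<le> M" and r: "p < M \<and> r = p * M / (M - p) \<or> p = M \<and> M < r"
    using assms by (auto simp: M_def)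
  consider "p < M" "r = p * M / (M - p)" | "p = M" "M < r"
    using r by blast
  then show thesis
  proof cases
    case 1
    define s where "s = p * (M - 1) / (M - p)"
    have "0 < s"
      using assms 1 by (simp add: s_def)
    show thesis
    proof (rule that[of "s powr p"])
      show "0 < s powr p"
        using \<open>0 < s\<close> by simp
    next
      fix a and I :: "'a set" and w :: "'a \<Rightarrow> real" and G
      assume "I \<subseteq> Basis" "card I = n" "has_continuous_gradient w G"
      then show "(\<integral>\<^sup>+y. ennreal \<bar>w (slice_point a I y)\<bar> epowr r \<partial>cube_measure I) epowr (p / r) \<le> ennreal (s powr p) *
          (\<integral>\<^sup>+y. ennreal (\<bar>w (slice_point a I y)\<bar> + norm (G (slice_point a I y))) epowr p \<partial>cube_measure I)"
        using Sobolev_cube[of w G I p a] assms 1 by (simp add: s_def M_def)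
    qed
  next
    case 2
    \<comment> \<open>The solution of \<open>p' M / (M - p') = r\<close>; it is above \<open>1\<close> because \<open>M \<ge> 2\<close> and \<open>r > 2\<close>.\<close>
    define p' where "p' = M * r / (M + r)"
    have "M + r < M * r"
    proof -
      have "1 < (M - 1) * (r - 1)"
        using mult_le_less_imp_less[of 1 "M - 1" 1 "r - 1"] assms 2 by simp
      then show ?thesis
        by (simp add: algebra_simps)
    qed
    then have p': "1 < p'" "p' < M"
      using assms 2 by (simp_all add: p'_def field_simps)
    have r': "p' * M / (M - p') = r"
    proof -
      have "M - p' = M * M / (M + r)"
        using assms 2 by (simp add: p'_def field_simps)
      then show ?thesis
        using assms 2 by (simp add: p'_def)
    qed
    define s where "s = p' * (M - 1) / (M - p')"
    have "0 < s"
      using assms p' by (simp add: s_def)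
    have ne: "p' \<noteq> 0" "p \<noteq> 0"
      using p' assms by auto
    define K where "K = (s powr p' * (2 ^ n) powr (1 - p' / p)) powr (p / p')"
    show thesis
    proof (rule that[of K])
      show "0 < K"
        using \<open>0 < s\<close> by (simp add: K_def)
    next
      fix a and I :: "'a set" and w :: "'a \<Rightarrow> real" and G
      assume I: "I \<subseteq> Basis" and n: "card I = n" and wG: "has_continuous_gradient w G"
      have fin: "finite I"
        using finite_subset[OF I] by simp
      have card: "real (card I) = M"
        by (simp add: n M_def)
      let ?A = "\<integral>\<^sup>+y. ennreal \<bar>w (slice_point a I y)\<bar> epowr r \<partial>cube_measure I"
      let ?D = "\<lambda>y. ennreal (\<bar>w (slice_point a I y)\<bar> + norm (G (slice_point a I y)))"
      have [measurable]: "w \<in> borel_measurable borel" "G \<in> borel_measurable borel"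
        using has_continuous_gradientD(2,3)[OF wG] by (auto intro: borel_measurable_continuous_onI)
      note [measurable] = measurable_slice_point[OF fin]
      have D [measurable]: "?D \<in> borel_measurable (cube_measure I)"
        by measurable
      have "?A epowr (p' / r) \<le> ennreal (s powr p') * (\<integral>\<^sup>+y. ?D y epowr p' \<partial>cube_measure I)"
        using Sobolev_cube[OF wG I, of p' a] assms p' by (simp add: card s_def r')
      also have "(\<integral>\<^sup>+y. ?D y epowr p' \<partial>cube_measure I)
          = (\<integral>\<^sup>+y. (?D y epowr p) epowr (p' / p) * 1 epowr (1 - p' / p) \<partial>cube_measure I)"
        using ne by (simp add: epowr_epowr)
      also have "\<dots> \<le> (\<integral>\<^sup>+y. ?D y epowr p \<partial>cube_measure I) epowr (p' / p)
          * (\<integral>\<^sup>+y. 1 \<partial>cube_measure I) epowr (1 - p' / p)"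
        using p' 2 by (intro Hoelder) auto
      also have "(\<integral>\<^sup>+y. 1 \<partial>cube_measure I) epowr (1 - p' / p) = ennreal ((2 ^ n) powr (1 - p' / p))"
        using ennreal_epowr[of "2 ^ n" "1 - p' / p"] emeasure_cube_measure_space[OF fin]
        by (simp add: n ennreal_power[symmetric])
      finally have "?A epowr (p' / r) \<le> ennreal (s powr p')
          * ((\<integral>\<^sup>+y. ?D y epowr p \<partial>cube_measure I) epowr (p' / p) * ennreal ((2 ^ n) powr (1 - p' / p)))"
        by (simp add: mult_left_mono)
      also have "\<dots> = ennreal (s powr p' * (2 ^ n) powr (1 - p' / p))
          * (\<integral>\<^sup>+y. ?D y epowr p \<partial>cube_measure I) epowr (p' / p)"
        by (simp add: ennreal_mult mult_ac)
      finally have "?A epowr (p' / r) \<le> \<dots>" .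
      then have "(?A epowr (p' / r)) epowr (p / p') \<le> (ennreal (s powr p' * (2 ^ n) powr (1 - p' / p))
          * (\<integral>\<^sup>+y. ?D y epowr p \<partial>cube_measure I) epowr (p' / p)) epowr (p / p')"
        using p' 2 by (intro epowr_mono) auto
      also have "\<dots> = ennreal K * (\<integral>\<^sup>+y. ?D y epowr p \<partial>cube_measure I)"
        using ne by (simp add: epowr_mult epowr_epowr ennreal_epowr K_def)
      finally show "?A epowr (p / r) \<le> ennreal K * (\<integral>\<^sup>+y. ?D y epowr p \<partial>cube_measure I)"
        using ne by (simp add: epowr_epowr)
    qed
  qed
qed

text \<open>
  For \<open>q = 1\<close> this is the bound of the supremum. For \<open>q > 1\<close> the Hoelder inequality with exponents
  \<open>q\<close> and \<open>q / (q - 1)\<close> leaves the norm of \<open>w\<close> with exponent \<open>r = p q / (q - 1)\<close>, and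
  \<open>q = n / p\<close> makes this the critical exponent \<open>p n / (n - p)\<close>.
\<close>

theorem weighted_Sobolev_cube:
  fixes p q :: real and n :: nat
  assumes p: "1 < p" and q: "p < n \<and> q = n / p \<or> p > n \<and> q = 1 \<or> p = n \<and> q > 1"
  obtains K where "0 < K"
    "\<And>a I (w :: 'a::euclidean_space \<Rightarrow> real) G H.
      I \<subseteq> Basis \<Longrightarrow> card I = n \<Longrightarrow> has_continuous_gradient w G \<Longrightarrow> H \<in> borel_measurable (cube_measure I) \<Longrightarrow>
      (\<integral>\<^sup>+y. H y * ennreal \<bar>w (slice_point a I y)\<bar> epowr p \<partial>cube_measure I) \<le>
      ennreal K * (\<integral>\<^sup>+y. H y epowr q \<partial>cube_measure I) epowr (1 / q) *
      (\<integral>\<^sup>+y. ennreal (\<bar>w (slice_point a I y)\<bar> + norm (G (slice_point a I y))) epowr p \<partial>cube_measure I)"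
proof (cases "q = 1")
  case True
  define M where "M = real n"
  have M: "0 \<le> M" and pM: "M < p"
    using True q p by (auto simp: M_def)
  define K where "K = (1 + 2 * M * p / (p - M)) powr p"
  show thesis
  proof (rule that[of K])
    have "0 < 1 + 2 * M * p / (p - M)"
      using p M pM by (intro add_pos_nonneg) auto
    then show "0 < K"
      by (simp add: K_def)
  next
    fix a and I :: "'a set" and w :: "'a \<Rightarrow> real" and G and H :: "('a \<Rightarrow> real) \<Rightarrow> ennreal"
    assume I: "I \<subseteq> Basis" and card: "card I = n" and wG: "has_continuous_gradient w G"
      and H: "H \<in> borel_measurable (cube_measure I)"
    let ?B = "\<integral>\<^sup>+y. ennreal (\<bar>w (slice_point a I y)\<bar> + norm (G (slice_point a I y))) epowr p \<partial>cube_measure I"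
    have "(\<integral>\<^sup>+y. H y * ennreal \<bar>w (slice_point a I y)\<bar> epowr p \<partial>cube_measure I)
        \<le> (\<integral>\<^sup>+y. H y * (ennreal K * ?B) \<partial>cube_measure I)"
      using Morrey_cube[OF wG I p, of _ a] pM finite_subset[OF I]
      by (intro nn_integral_cube_mono mult_left_mono) (auto simp: card K_def M_def)
    also have "\<dots> = ennreal K * (\<integral>\<^sup>+y. H y epowr q \<partial>cube_measure I) epowr (1 / q) * ?B"
      using nn_integral_multc[OF H, of "ennreal K * ?B"] by (simp add: True mult_ac)
    finally show "(\<integral>\<^sup>+y. H y * ennreal \<bar>w (slice_point a I y)\<bar> epowr p \<partial>cube_measure I)
        \<le> ennreal K * (\<integral>\<^sup>+y. H y epowr q \<partial>cube_measure I) epowr (1 / q) * ?B" .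
  qed
next
  case False
  define M where "M = real n"
  have q1: "1 < q" and pM: "p \<le> M"
    using False q p by (auto simp: M_def less_divide_eq)
  define r where "r = p * q / (q - 1)"
  have qr: "1 - 1 / q = p / r" "r * (p / r) = p" "p / r > 0"
    using q1 p by (simp_all add: r_def field_simps)
  have n2: "2 \<le> n"
    using pM p by (simp add: M_def)
  have r_cases: "p < n \<and> r = p * n / (n - p) \<or> p = n \<and> n < r"
    using q q1 pM p by (auto simp: r_def M_def field_simps)
  obtain K where K: "0 < K"
    "\<And>a I (w :: 'a \<Rightarrow> real) G. I \<subseteq> Basis \<Longrightarrow> card I = n \<Longrightarrow> has_continuous_gradient w G \<Longrightarrow>
    (\<integral>\<^sup>+y. ennreal \<bar>w (slice_point a I y)\<bar> epowr r \<partial>cube_measure I) epowr (p / r) \<le> ennreal K *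
    (\<integral>\<^sup>+y. ennreal (\<bar>w (slice_point a I y)\<bar> + norm (G (slice_point a I y))) epowr p \<partial>cube_measure I)"
    using Sobolev_cube_exponents[OF p n2 r_cases, where 'a = 'a] by blast
  show thesis
  proof (rule that[OF K(1)])
    fix a and I :: "'a set" and w :: "'a \<Rightarrow> real" and G and H :: "('a \<Rightarrow> real) \<Rightarrow> ennreal"
    assume I: "I \<subseteq> Basis" and card: "card I = n" and wG: "has_continuous_gradient w G"
      and H [measurable]: "H \<in> borel_measurable (cube_measure I)"
    let ?W = "\<lambda>y. ennreal \<bar>w (slice_point a I y)\<bar>"
    let ?B = "\<integral>\<^sup>+y. ennreal (\<bar>w (slice_point a I y)\<bar> + norm (G (slice_point a I y))) epowr p \<partial>cube_measure I"
    have fin: "finite I"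
      using finite_subset[OF I] by simp
    have [measurable]: "w \<in> borel_measurable borel"
      using has_continuous_gradientD(3)[OF wG] by (auto intro: borel_measurable_continuous_onI)
    note [measurable] = measurable_slice_point[OF fin]
    have W [measurable]: "?W \<in> borel_measurable (cube_measure I)"
      by measurable
    have "(\<integral>\<^sup>+y. H y * ?W y epowr p \<partial>cube_measure I)
        = (\<integral>\<^sup>+y. (H y epowr q) epowr (1 / q) * (?W y epowr r) epowr (1 - 1 / q) \<partial>cube_measure I)"
      unfolding qr epowr_epowr using q1 by simp
    also have "\<dots> \<le> (\<integral>\<^sup>+y. H y epowr q \<partial>cube_measure I) epowr (1 / q)
        * (\<integral>\<^sup>+y. ?W y epowr r \<partial>cube_measure I) epowr (1 - 1 / q)"
      using q1 by (intro Hoelder) auto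
    also have "\<dots> \<le> (\<integral>\<^sup>+y. H y epowr q \<partial>cube_measure I) epowr (1 / q) * (ennreal K * ?B)"
      unfolding qr by (intro mult_left_mono K I card wG) simp
    finally show "(\<integral>\<^sup>+y. H y * ?W y epowr p \<partial>cube_measure I)
        \<le> ennreal K * (\<integral>\<^sup>+y. H y epowr q \<partial>cube_measure I) epowr (1 / q) * ?B"
      by (simp add: mult_ac)
  qed
qed

section \<open>Pyramid coordinates\<close>

definition pyramid :: "'a::euclidean_space \<Rightarrow> 'a set" where
  "pyramid b = {x. 0 < x \<bullet> b \<and> (\<forall>c\<in>Basis. \<bar>x \<bullet> c\<bar> \<le> x \<bullet> b)}"

lemma sets_pyramid [measurable]: "pyramid b \<in> sets borel"
  unfolding pyramid_def by measurable

lemma slice_point_inner: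
  assumes "I \<subseteq> Basis" "c \<in> Basis"
  shows "slice_point a I y \<bullet> c = a \<bullet> c + (if c \<in> I then y c else 0)"
proof -
  have "(\<Sum>d\<in>I. y d *\<^sub>R d) \<bullet> c = (\<Sum>d\<in>I. if d = c then y d else 0)"
    unfolding inner_sum_left using assms by (intro sum.cong) (auto simp: inner_Basis subset_iff)
  also have "\<dots> = (if c \<in> I then y c else 0)"
    using finite_subset[OF assms(1)] by (simp add: sum.delta)
  finally show ?thesis
    by (simp add: slice_point_def inner_add_left)
qed

lemma scaled_slice_in_pyramid_iff:
  fixes b :: "'a::euclidean_space"
  assumes b: "b \<in> Basis" and \<sigma>: "\<sigma> = 1 \<or> \<sigma> = -1" and t: "0 < t"
    and y: "y \<in> space (\<Pi>\<^sub>M i\<in>Basis - {b}. lborel)"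
  shows "t *\<^sub>R slice_point (\<sigma> *\<^sub>R b) (Basis - {b}) y \<in> pyramid (\<sigma> *\<^sub>R b) \<longleftrightarrow> y \<in> cube (Basis - {b})"
proof -
  let ?x = "slice_point (\<sigma> *\<^sub>R b) (Basis - {b}) y"
  have xb: "?x \<bullet> b = \<sigma>"
    using b by (simp add: slice_point_inner)
  have xc: "?x \<bullet> c = y c" if "c \<in> Basis - {b}" for c
    using b that by (auto simp: slice_point_inner inner_Basis)
  have "\<sigma> * \<sigma> = 1" "\<bar>\<sigma>\<bar> = 1"
    using \<sigma> by auto
  then have "t *\<^sub>R ?x \<in> pyramid (\<sigma> *\<^sub>R b) \<longleftrightarrow> (\<forall>c\<in>Basis. t * \<bar>?x \<bullet> c\<bar> \<le> t)"
    using t by (auto simp: pyramid_def xb abs_mult mult.left_commute[of _ t])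
  also have "\<dots> \<longleftrightarrow> (\<forall>c\<in>Basis. \<bar>?x \<bullet> c\<bar> \<le> 1)"
    using t by simp
  also have "\<dots> \<longleftrightarrow> (\<forall>c\<in>Basis - {b}. \<bar>y c\<bar> \<le> 1)"
    using xb xc \<open>\<bar>\<sigma>\<bar> = 1\<close> by (metis DiffI Diff_iff insert_iff order_refl singletonD)
  also have "\<dots> \<longleftrightarrow> y \<in> cube (Basis - {b})"
    using y by (auto simp: cube_def space_PiM PiE_iff abs_le_iff)
  finally show ?thesis .
qed

text \<open>
  Fubini separates the coordinate \<open>\<plusminus>t\<close> in the direction \<open>b\<close> from the others, and the others are
  rescaled by \<open>t\<close>; in the rescaled coordinates the section of the pyramid at height \<open>t\<close> is the cube.
\<close>

theorem nn_integral_pyramid: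
  fixes b :: "'a::euclidean_space" and F :: "'a \<Rightarrow> ennreal"
  assumes b: "b \<in> Basis" and \<sigma>: "\<sigma> = 1 \<or> \<sigma> = -1" and F [measurable]: "F \<in> borel_measurable borel"
  shows "(\<integral>\<^sup>+x. F x * indicator (pyramid (\<sigma> *\<^sub>R b)) x \<partial>lborel)
    = (\<integral>\<^sup>+t. ennreal (t ^ (DIM('a) - 1)) * indicator {0<..} t *
        (\<integral>\<^sup>+y. F (t *\<^sub>R slice_point (\<sigma> *\<^sub>R b) (Basis - {b}) y) \<partial>cube_measure (Basis - {b})) \<partial>lborel)"
proof -
  define I where "I = (Basis :: 'a set) - {b}"
  have I: "finite I" "b \<notin> I" "insert b I = Basis" "I \<subseteq> Basis" "card I = DIM('a) - 1"
    using b by (auto simp: I_def)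
  let ?P = "\<lambda>I. \<Pi>\<^sub>M i\<in>I. lborel :: real measure"
  define H where "H x = F x * indicator (pyramid (\<sigma> *\<^sub>R b)) x" for x
  have H [measurable]: "H \<in> borel_measurable borel"
    unfolding H_def[abs_def] by measurable
  note [measurable] = measurable_slice_point[OF I(1)]
  have upd: "(\<Sum>c\<in>Basis. (y(b := t)) c *\<^sub>R c) = slice_point (t *\<^sub>R b) I y" for y t
  proof -
    have "(\<Sum>c\<in>I. (y(b := t)) c *\<^sub>R c) = (\<Sum>c\<in>I. y c *\<^sub>R c)"
      using I(2) by (intro sum.cong) auto
    moreover have "(\<Sum>c\<in>Basis. (y(b := t)) c *\<^sub>R c) = (\<Sum>c\<in>insert b I. (y(b := t)) c *\<^sub>R c)"
      by (simp only: I(3))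
    ultimately show ?thesis
      by (simp only: sum.insert[OF I(1,2)]) (simp add: slice_point_def)
  qed
  interpret P: finite_product_sigma_finite "\<lambda>_. lborel :: real measure" I
    by standard (rule I)
  have joint: "(\<lambda>(t, y). slice_point (t *\<^sub>R b) I y) \<in> lborel \<Otimes>\<^sub>M ?P I \<rightarrow>\<^sub>M borel"
    unfolding slice_point_def[abs_def] by measurable
  have meas: "(\<lambda>t. \<integral>\<^sup>+y. H (slice_point (t *\<^sub>R b) I y) \<partial>?P I) \<in> borel_measurable borel"
  proof -
    have "(\<lambda>t. \<integral>\<^sup>+y. H (slice_point (t *\<^sub>R b) I y) \<partial>?P I) \<in> borel_measurable lborel"
      using measurable_compose[OF joint H]
      by (intro P.borel_measurable_nn_integral) (simp add: case_prod_beta')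
    then show ?thesis
      by simp
  qed
  have "(\<integral>\<^sup>+x. H x \<partial>lborel) = (\<integral>\<^sup>+y. H (\<Sum>c\<in>Basis. y c *\<^sub>R c) \<partial>?P Basis)"
    by (subst lborel_eq) (simp add: nn_integral_distr)
  also have "\<dots> = (\<integral>\<^sup>+t. \<integral>\<^sup>+y. H (\<Sum>c\<in>Basis. (y(b := t)) c *\<^sub>R c) \<partial>?P I \<partial>lborel)"
    using lborel_product.product_nn_integral_insert_rev[OF I(1,2), of "\<lambda>y. H (\<Sum>c\<in>Basis. y c *\<^sub>R c)"]
    by (simp add: I(3))
  also have "\<dots> = (\<integral>\<^sup>+t. \<integral>\<^sup>+y. H (slice_point (t *\<^sub>R b) I y) \<partial>?P I \<partial>lborel)"
    unfolding upd ..
  also have "\<dots> = (\<integral>\<^sup>+t. \<integral>\<^sup>+y. H (slice_point ((\<sigma> * t) *\<^sub>R b) I y) \<partial>?P I \<partial>lborel)"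
    using nn_integral_real_affine[OF meas, of \<sigma> 0] \<sigma> by auto
  also have "\<dots> = (\<integral>\<^sup>+t. ennreal (t ^ card I) * indicator {0<..} t *
        (\<integral>\<^sup>+y. F (t *\<^sub>R slice_point (\<sigma> *\<^sub>R b) I y) \<partial>cube_measure I) \<partial>lborel)"
  proof (rule nn_integral_cong)
    fix t :: real
    show "(\<integral>\<^sup>+y. H (slice_point ((\<sigma> * t) *\<^sub>R b) I y) \<partial>?P I)
      = ennreal (t ^ card I) * indicator {0<..} t *
        (\<integral>\<^sup>+y. F (t *\<^sub>R slice_point (\<sigma> *\<^sub>R b) I y) \<partial>cube_measure I)"
    proof (cases "0 < t")
      case True
      have scale: "slice_point ((\<sigma> * t) *\<^sub>R b) I (\<lambda>i\<in>I. 0 + t * y i) = t *\<^sub>R slice_point (\<sigma> *\<^sub>R b) I y" for y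
        by (simp add: slice_point_def scaleR_sum_right scaleR_add_right mult.commute)
      have "(\<integral>\<^sup>+y. H (slice_point ((\<sigma> * t) *\<^sub>R b) I y) \<partial>?P I)
          = ennreal (\<bar>t\<bar> ^ card I) * (\<integral>\<^sup>+y. H (slice_point ((\<sigma> * t) *\<^sub>R b) I (\<lambda>i\<in>I. 0 + t * y i)) \<partial>?P I)"
        using True by (intro nn_integral_PiM_lborel_affine I) auto
      also have "(\<integral>\<^sup>+y. H (slice_point ((\<sigma> * t) *\<^sub>R b) I (\<lambda>i\<in>I. 0 + t * y i)) \<partial>?P I)
          = (\<integral>\<^sup>+y. F (t *\<^sub>R slice_point (\<sigma> *\<^sub>R b) I y) * indicator (cube I) y \<partial>?P I)"
        unfolding scale H_def
        using scaled_slice_in_pyramid_iff[OF b \<sigma> True]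
        by (intro nn_integral_cong) (auto simp: I_def split: split_indicator)
      also have "\<dots> = (\<integral>\<^sup>+y. F (t *\<^sub>R slice_point (\<sigma> *\<^sub>R b) I y) \<partial>cube_measure I)"
        by (intro nn_integral_cube_measure[symmetric] I) measurable
      finally show ?thesis
        using True by simp
    next
      case False
      have "\<sigma> * \<sigma> = 1"
        using \<sigma> by auto
      then have "slice_point ((\<sigma> * t) *\<^sub>R b) I y \<bullet> (\<sigma> *\<^sub>R b) = t" for y
        using b I by (simp add: slice_point_inner mult.left_commute)
      then have "H (slice_point ((\<sigma> * t) *\<^sub>R b) I y) = 0" for y
        using False by (auto simp: H_def pyramid_def split: split_indicator)
      then show ?thesis
        using False by simp
    qed
  qed
  finally show ?thesis
    unfolding I(5) by (simp add: H_def I_def)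
qed

text \<open>
  The pyramid is found at a coordinate of largest absolute value.
\<close>

lemma ex_pyramid:
  fixes x :: "'a::euclidean_space"
  assumes "x \<noteq> 0"
  shows "\<exists>b\<in>Basis. \<exists>\<sigma>\<in>{1, -1}. x \<in> pyramid (\<sigma> *\<^sub>R b)"
proof -
  obtain b where b: "b \<in> Basis" "\<And>c. c \<in> Basis \<Longrightarrow> \<bar>x \<bullet> c\<bar> \<le> \<bar>x \<bullet> b\<bar>"
  proof -
    let ?S = "(\<lambda>c. \<bar>x \<bullet> c\<bar>) ` Basis"
    have "Max ?S \<in> ?S"
      by (intro Max_in) auto
    then obtain b where b: "b \<in> Basis" "Max ?S = \<bar>x \<bullet> b\<bar>"
      by (rule imageE) (rule that)
    show thesis
    proof (rule that[OF b(1)])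
      show "\<bar>x \<bullet> c\<bar> \<le> \<bar>x \<bullet> b\<bar>" if "c \<in> Basis" for c
        unfolding b(2)[symmetric] using that by (intro Max_ge) auto
    qed
  qed
  have "x \<bullet> b \<noteq> 0"
    using assms b by (metis abs_0 abs_le_zero_iff euclidean_all_zero_iff)
  define \<sigma> :: real where "\<sigma> = sgn (x \<bullet> b)"
  have "x \<in> pyramid (\<sigma> *\<^sub>R b)"
    using b \<open>x \<bullet> b \<noteq> 0\<close> by (auto simp: pyramid_def \<sigma>_def abs_sgn mult.commute zero_less_abs_iff simp flip: abs_sgn)
  moreover have "\<sigma> \<in> {1, -1}"
    using \<open>x \<bullet> b \<noteq> 0\<close> by (auto simp: \<sigma>_def sgn_real_def)
  ultimately show ?thesis
    using b(1) by blast
qed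

lemma nn_integral_le_sum_pyramids:
  fixes F :: "'a::euclidean_space \<Rightarrow> ennreal"
  assumes F [measurable]: "F \<in> borel_measurable borel"
  shows "(\<integral>\<^sup>+x. F x \<partial>lborel)
    \<le> (\<Sum>b\<in>Basis. \<Sum>\<sigma>\<in>{1, -1}. \<integral>\<^sup>+x. F x * indicator (pyramid (\<sigma> *\<^sub>R b)) x \<partial>lborel)"
proof -
  have "(\<integral>\<^sup>+x. F x \<partial>lborel)
      \<le> (\<integral>\<^sup>+x. (\<Sum>b\<in>Basis. \<Sum>\<sigma>\<in>{1, -1}. F x * indicator (pyramid (\<sigma> *\<^sub>R b)) x) \<partial>lborel)"
  proof (rule nn_integral_mono_AE)
    have "AE x in lborel. x \<noteq> (0::'a)"
      by (rule AE_lborel_singleton)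
    then show "AE x in lborel. F x
        \<le> (\<Sum>b\<in>Basis. \<Sum>\<sigma>\<in>{1, -1}. F x * indicator (pyramid (\<sigma> *\<^sub>R b)) x)"
    proof eventually_elim
      case (elim x)
      obtain b \<sigma> where *: "b \<in> Basis" "\<sigma> \<in> {1, -1::real}" "x \<in> pyramid (\<sigma> *\<^sub>R b)"
        using ex_pyramid[OF elim] by blast
      have "F x = F x * indicator (pyramid (\<sigma> *\<^sub>R b)) x"
        using * by simp
      also have "\<dots> \<le> (\<Sum>\<sigma>\<in>{1, -1}. F x * indicator (pyramid (\<sigma> *\<^sub>R b)) x)"
        using *(2) by (intro member_le_sum) auto
      also have "\<dots> \<le> (\<Sum>b\<in>Basis. \<Sum>\<sigma>\<in>{1, -1}. F x * indicator (pyramid (\<sigma> *\<^sub>R b)) x)"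
        using *(1) by (intro member_le_sum[of b]) auto
      finally show ?case .
    qed
  qed
  also have "\<dots> = (\<Sum>b\<in>Basis. \<Sum>\<sigma>\<in>{1, -1}. \<integral>\<^sup>+x. F x * indicator (pyramid (\<sigma> *\<^sub>R b)) x \<partial>lborel)"
  proof -
    have "(\<integral>\<^sup>+x. (\<Sum>\<sigma>\<in>{1, -1}. F x * indicator (pyramid (\<sigma> *\<^sub>R b)) x) \<partial>lborel)
        = (\<Sum>\<sigma>\<in>{1, -1}. \<integral>\<^sup>+x. F x * indicator (pyramid (\<sigma> *\<^sub>R b)) x \<partial>lborel)" for b
      by (rule nn_integral_sum) measurable
    moreover have "(\<integral>\<^sup>+x. (\<Sum>b\<in>Basis. \<Sum>\<sigma>\<in>{1, -1}. F x * indicator (pyramid (\<sigma> *\<^sub>R b)) x) \<partial>lborel)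
        = (\<Sum>b\<in>Basis. \<integral>\<^sup>+x. (\<Sum>\<sigma>\<in>{1, -1}. F x * indicator (pyramid (\<sigma> *\<^sub>R b)) x) \<partial>lborel)"
      by (rule nn_integral_sum) measurable
    ultimately show ?thesis
      by simp
  qed
  finally show ?thesis .
qed

section \<open>The Hardy inequality\<close>

lemma nn_integral_lborel_scale:
  fixes F :: "'a::euclidean_space \<Rightarrow> ennreal"
  assumes [measurable]: "F \<in> borel_measurable borel" and s: "0 < s"
  shows "(\<integral>\<^sup>+x. F x \<partial>lborel) = ennreal (s ^ DIM('a)) * (\<integral>\<^sup>+x. F (s *\<^sub>R x) \<partial>lborel)"
  using s
  by (subst lborel_affine[of s 0]) (simp_all add: nn_integral_density nn_integral_distr nn_integral_cmult)

lemma nn_integral_powr_at_infinity: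
  assumes "e < -1"
  shows "(\<integral>\<^sup>+s. ennreal (s powr e) * indicator {1..} s \<partial>lborel) = ennreal (- 1 / (e + 1))"
  using has_integral_powr_to_inf[OF assms, of 1]
  by (intro nn_integral_has_integral_lebesgue') auto

text \<open>
  As \<open>u\<close> vanishes far away, \<open>|u x| \<le> |x| \<integral> |G (s x)| ds\<close> over \<open>s \<ge> 1\<close>. The Hoelder inequality with the
  weight \<open>s\<^sup>\<gamma>\<close> bounds the \<open>p\<close>-th power of the integral by a constant times
  \<open>\<integral> s\<^sup>\<gamma> |G (s x)|\<^sup>p ds\<close>, and after exchanging the integrals, the substitution \<open>s x \<mapsto> x\<close> gives the factor
  \<open>s\<^bsup>\<gamma> + \<alpha> - N\<^esup>\<close>. The two integrals over \<open>s\<close> converge for \<open>p - 1 < \<gamma> < N - \<alpha> - 1\<close>; the value of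
  \<open>\<gamma>\<close> is the midpoint of this interval, which is nonempty because \<open>p + \<alpha> < N\<close>.
\<close>

theorem Hardy_inequality:
  fixes u :: "'a::euclidean_space \<Rightarrow> real" and p \<alpha> :: real
  assumes p: "1 < p" and \<alpha>: "p + \<alpha> < real DIM('a)"
    and uG: "has_continuous_gradient u G" and supp: "\<And>x. R < norm x \<Longrightarrow> u x = 0"
  defines "\<gamma> \<equiv> (p + real DIM('a) - \<alpha> - 2) / 2"
  defines "K \<equiv> (1 / (\<gamma> / (p - 1) - 1)) powr (p - 1) * (1 / (real DIM('a) - \<alpha> - \<gamma> - 1))"
  shows "(\<integral>\<^sup>+x. ennreal (norm x powr - (p + \<alpha>)) * ennreal \<bar>u x\<bar> epowr p \<partial>lborel)
    \<le> ennreal K * (\<integral>\<^sup>+x. ennreal (norm x powr - \<alpha>) * ennreal (norm (G x)) epowr p \<partial>lborel)"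
proof -
  define N where "N = real DIM('a)"
  have \<gamma>: "\<gamma> / (p - 1) > 1" "\<gamma> < N - \<alpha> - 1"
    using p \<alpha> by (simp_all add: \<gamma>_def N_def field_simps)
  have [measurable]: "u \<in> borel_measurable borel" "G \<in> borel_measurable borel"
    using has_continuous_gradientD(2,3)[OF uG] by (auto intro: borel_measurable_continuous_onI)
  define c0 where "c0 = 1 / (\<gamma> / (p - 1) - 1)"
  have c0: "0 < c0"
    using \<gamma> by (simp add: c0_def)
  let ?J = "\<integral>\<^sup>+x. ennreal (norm x powr - \<alpha>) * ennreal (norm (G x)) epowr p \<partial>lborel"
  let ?I = "\<lambda>x. \<integral>\<^sup>+s. (ennreal (s powr \<gamma>) * ennreal (norm (G (s *\<^sub>R x))) epowr p) * indicator {1..} s \<partial>lborel"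
  have ray: "ennreal \<bar>u x\<bar> \<le> ennreal (norm x) *
      (\<integral>\<^sup>+s. ennreal (norm (G (s *\<^sub>R x))) * indicator {1..} s \<partial>lborel)" if "x \<noteq> 0" for x
  proof -
    \<comment> \<open>A point on the ray through \<open>x\<close>, beyond \<open>x\<close> and outside the support of \<open>u\<close>.\<close>
    define T where "T = max 1 ((\<bar>R\<bar> + 1) / norm x)"
    have "1 \<le> T"
      by (simp add: T_def)
    have "(\<bar>R\<bar> + 1) / norm x \<le> T"
      by (simp add: T_def)
    then have "R < norm (T *\<^sub>R x)"
      using that \<open>1 \<le> T\<close> by (simp add: field_simps)
    then have "u (T *\<^sub>R x) = 0"
      by (rule supp)
    then have "ennreal \<bar>u x\<bar> = ennreal \<bar>u (0 + T *\<^sub>R x) - u (0 + 1 *\<^sub>R x)\<bar>"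
      by simp
    also have "\<dots> \<le> (\<integral>\<^sup>+s. ennreal \<bar>G (0 + s *\<^sub>R x) \<bullet> x\<bar> * indicator {1..T} s \<partial>lborel)"
      using \<open>1 \<le> T\<close> by (intro abs_increment_le_nn_integral has_continuous_gradient_line[OF uG]
          continuous_intros continuous_on_compose2[OF has_continuous_gradientD(2)[OF uG]]) auto
    also have "\<dots> \<le> (\<integral>\<^sup>+s. ennreal (norm x) * (ennreal (norm (G (s *\<^sub>R x))) * indicator {1..} s) \<partial>lborel)"
    proof (intro nn_integral_mono)
      fix s
      have "ennreal \<bar>G (s *\<^sub>R x) \<bullet> x\<bar> \<le> ennreal (norm x) * ennreal (norm (G (s *\<^sub>R x)))"
        using Cauchy_Schwarz_ineq2[of "G (s *\<^sub>R x)" x]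
        by (simp add: mult.commute ennreal_leI flip: ennreal_mult)
      then show "ennreal \<bar>G (0 + s *\<^sub>R x) \<bullet> x\<bar> * indicator {1..T} s
          \<le> ennreal (norm x) * (ennreal (norm (G (s *\<^sub>R x))) * indicator {1..} s)"
        by (auto split: split_indicator)
    qed
    finally show ?thesis
      by (simp add: nn_integral_cmult)
  qed
  have pt: "ennreal (norm x powr - (p + \<alpha>)) * ennreal \<bar>u x\<bar> epowr p
      \<le> ennreal (c0 powr (p - 1)) * (ennreal (norm x powr - \<alpha>) * ?I x)" if x: "x \<noteq> 0" for x
  proof -
    have "(\<integral>\<^sup>+s. ennreal (norm (G (s *\<^sub>R x))) * indicator {1..} s \<partial>lborel)
        = (\<integral>\<^sup>+s. ((ennreal (s powr \<gamma>) * ennreal (norm (G (s *\<^sub>R x))) epowr p) * indicator {1..} s) epowr (1 / p)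
            * (ennreal (s powr (- \<gamma> / (p - 1))) * indicator {1..} s) epowr (1 - 1 / p) \<partial>lborel)"
    proof (intro nn_integral_cong)
      fix s :: real
      have "\<gamma> / p + (- \<gamma> / (p - 1)) * (1 - 1 / p) = 0"
        using p by (simp add: field_simps)
      then have "s powr (\<gamma> / p) * s powr ((- \<gamma> / (p - 1)) * (1 - 1 / p)) = 1" if "1 \<le> s"
        using that unfolding powr_add[symmetric] by simp
      then have "ennreal (s powr (\<gamma> / p)) * ennreal (s powr ((- \<gamma> / (p - 1)) * (1 - 1 / p))) = 1" if "1 \<le> s"
        using that by (simp flip: ennreal_mult)
      then show "ennreal (norm (G (s *\<^sub>R x))) * indicator {1..} s =
        ((ennreal (s powr \<gamma>) * ennreal (norm (G (s *\<^sub>R x))) epowr p) * indicator {1..} s) epowr (1 / p)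
            * (ennreal (s powr (- \<gamma> / (p - 1))) * indicator {1..} s) epowr (1 - 1 / p)"
        using p
        by (cases "1 \<le> s") (simp_all add: epowr_mult epowr_epowr ennreal_epowr powr_powr mult_ac
            mult.left_commute[of "ennreal (norm _)"])
    qed
    also have "\<dots> \<le> ?I x epowr (1 / p)
        * (\<integral>\<^sup>+s. ennreal (s powr (- \<gamma> / (p - 1))) * indicator {1..} s \<partial>lborel) epowr (1 - 1 / p)"
      using p by (intro Hoelder) auto
    also have "(\<integral>\<^sup>+s. ennreal (s powr (- \<gamma> / (p - 1))) * indicator {1..} s \<partial>lborel) = ennreal c0"
    proof -
      have "- 1 / (- \<gamma> / (p - 1) + 1) = c0"
        using minus_divide_divide[of 1 "\<gamma> / (p - 1) - 1"] by (simp add: c0_def)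
      then show ?thesis
        using \<gamma> nn_integral_powr_at_infinity[of "- \<gamma> / (p - 1)"] by simp
    qed
    finally have "ennreal \<bar>u x\<bar> epowr p
        \<le> (ennreal (norm x) * (?I x epowr (1 / p) * ennreal c0 epowr (1 - 1 / p))) epowr p"
      using p by (intro epowr_mono order_trans[OF ray[OF x]] mult_left_mono) auto
    also have "\<dots> = ennreal (norm x powr p) * (?I x * ennreal (c0 powr (p - 1)))"
    proof -
      have "(1 - 1 / p) * p = p - 1"
        using p by (simp add: field_simps)
      then show ?thesis
        using p c0 by (simp add: epowr_mult epowr_epowr ennreal_epowr powr_powr)
    qed
    finally have "ennreal (norm x powr - (p + \<alpha>)) * ennreal \<bar>u x\<bar> epowr p
        \<le> ennreal (norm x powr - (p + \<alpha>)) * (ennreal (norm x powr p) * (?I x * ennreal (c0 powr (p - 1))))"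
      by (rule mult_left_mono) simp
    also have "\<dots> = ennreal (norm x powr - (p + \<alpha>) * norm x powr p) * (?I x * ennreal (c0 powr (p - 1)))"
      by (simp add: ennreal_mult mult.assoc)
    also have "norm x powr - (p + \<alpha>) * norm x powr p = norm x powr - \<alpha>"
      by (simp flip: powr_add)
    finally show ?thesis
      by (simp add: mult_ac)
  qed
  have "(\<integral>\<^sup>+x. ennreal (norm x powr - (p + \<alpha>)) * ennreal \<bar>u x\<bar> epowr p \<partial>lborel)
      \<le> (\<integral>\<^sup>+x. ennreal (c0 powr (p - 1)) * (ennreal (norm x powr - \<alpha>) * ?I x) \<partial>lborel)"
    using AE_lborel_singleton[of "0::'a"] pt by (intro nn_integral_mono_AE) auto
  also have "\<dots> = ennreal (c0 powr (p - 1)) * (\<integral>\<^sup>+x. ennreal (norm x powr - \<alpha>) * ?I x \<partial>lborel)"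
    by (intro nn_integral_cmult) measurable
  also have "(\<integral>\<^sup>+x. ennreal (norm x powr - \<alpha>) * ?I x \<partial>lborel)
      = (\<integral>\<^sup>+x. (\<integral>\<^sup>+s. ennreal (norm x powr - \<alpha>) *
          ((ennreal (s powr \<gamma>) * ennreal (norm (G (s *\<^sub>R x))) epowr p) * indicator {1..} s) \<partial>lborel) \<partial>lborel)"
    by (intro nn_integral_cong nn_integral_cmult[symmetric]) measurable
  also have "\<dots> = (\<integral>\<^sup>+s. (\<integral>\<^sup>+x. ennreal (norm x powr - \<alpha>) *
          ((ennreal (s powr \<gamma>) * ennreal (norm (G (s *\<^sub>R x))) epowr p) * indicator {1..} s) \<partial>lborel) \<partial>lborel)"
    by (rule lborel_pair.Fubini') measurable
  also have "\<dots> = (\<integral>\<^sup>+s. ennreal (s powr (\<gamma> + \<alpha> - N)) * indicator {1..} s * ?J \<partial>lborel)"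
  proof (intro nn_integral_cong)
    fix s :: real
    show "(\<integral>\<^sup>+x. ennreal (norm x powr - \<alpha>) *
          ((ennreal (s powr \<gamma>) * ennreal (norm (G (s *\<^sub>R x))) epowr p) * indicator {1..} s) \<partial>lborel)
        = ennreal (s powr (\<gamma> + \<alpha> - N)) * indicator {1..} s * ?J"
    proof (cases "1 \<le> s")
      case True
      have "(\<integral>\<^sup>+x. ennreal (norm x powr - \<alpha>) *
          ((ennreal (s powr \<gamma>) * ennreal (norm (G (s *\<^sub>R x))) epowr p) * indicator {1..} s) \<partial>lborel)
        = (\<integral>\<^sup>+x. ennreal (s powr (\<gamma> + \<alpha>)) *
            (ennreal (norm (s *\<^sub>R x) powr - \<alpha>) * ennreal (norm (G (s *\<^sub>R x))) epowr p) \<partial>lborel)"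
      proof (intro nn_integral_cong)
        fix x :: 'a
        have "s powr (\<gamma> + \<alpha>) * norm (s *\<^sub>R x) powr - \<alpha> = norm x powr - \<alpha> * s powr \<gamma>"
          using True by (simp add: powr_mult powr_add powr_minus)
        then have "ennreal (s powr (\<gamma> + \<alpha>)) * ennreal (norm (s *\<^sub>R x) powr - \<alpha>)
            = ennreal (norm x powr - \<alpha>) * ennreal (s powr \<gamma>)"
          by (simp flip: ennreal_mult)
        then show "ennreal (norm x powr - \<alpha>) *
          ((ennreal (s powr \<gamma>) * ennreal (norm (G (s *\<^sub>R x))) epowr p) * indicator {1..} s)
          = ennreal (s powr (\<gamma> + \<alpha>)) *
            (ennreal (norm (s *\<^sub>R x) powr - \<alpha>) * ennreal (norm (G (s *\<^sub>R x))) epowr p)"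
          using True by (simp flip: mult.assoc)
      qed
      also have "\<dots> = ennreal (s powr (\<gamma> + \<alpha>)) *
          (\<integral>\<^sup>+x. ennreal (norm (s *\<^sub>R x) powr - \<alpha>) * ennreal (norm (G (s *\<^sub>R x))) epowr p \<partial>lborel)"
        by (intro nn_integral_cmult) measurable
      also have "\<dots> = ennreal (s powr (\<gamma> + \<alpha> - N)) * (ennreal (s ^ DIM('a)) *
          (\<integral>\<^sup>+x. ennreal (norm (s *\<^sub>R x) powr - \<alpha>) * ennreal (norm (G (s *\<^sub>R x))) epowr p \<partial>lborel))"
        using True by (simp add: N_def powr_diff powr_realpow flip: mult.assoc ennreal_mult)
      also have "ennreal (s ^ DIM('a)) *
          (\<integral>\<^sup>+x. ennreal (norm (s *\<^sub>R x) powr - \<alpha>) * ennreal (norm (G (s *\<^sub>R x))) epowr p \<partial>lborel) = ?J"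
        using True by (intro nn_integral_lborel_scale[symmetric]) auto
      finally show ?thesis
        using True by simp
    qed simp
  qed
  also have "\<dots> = ennreal (1 / (N - \<alpha> - \<gamma> - 1)) * ?J"
  proof -
    have "- 1 / (\<gamma> + \<alpha> - N + 1) = 1 / (N - \<alpha> - \<gamma> - 1)"
      using minus_divide_divide[of 1 "N - \<alpha> - \<gamma> - 1"] by (simp add: algebra_simps)
    then show ?thesis
      using \<gamma> nn_integral_powr_at_infinity[of "\<gamma> + \<alpha> - N"] by (simp add: nn_integral_multc)
  qed
  also have "ennreal (c0 powr (p - 1)) * \<dots> = ennreal K * ?J"
  proof -
    have "ennreal K = ennreal (c0 powr (p - 1)) * ennreal (1 / (N - \<alpha> - \<gamma> - 1))"
      unfolding K_def c0_def N_def using \<gamma> by (intro ennreal_mult) (auto simp: N_def)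
    then show ?thesis
      by (simp only: mult.assoc)
  qed
  finally show ?thesis .
qed

section \<open>Radial functions and the surface measure\<close>

lemma nn_integral_borel_sphere_measure:
  fixes f :: "'a::euclidean_space \<Rightarrow> ennreal"
  assumes f [measurable]: "f \<in> borel_measurable borel"
  shows "(\<integral>\<^sup>+\<theta>. f \<theta> \<partial>borel_sphere_measure)
    = of_nat DIM('a) * (\<integral>\<^sup>+x. f (x /\<^sub>R norm x) * indicator (cball 0 1 - {0}) x \<partial>lborel)"
proof -
  have fr: "f \<in> borel_measurable (restrict_space borel (sphere 0 1))"
    by (intro measurable_restrict_space1 f)
  have "(\<integral>\<^sup>+\<theta>. f \<theta> \<partial>borel_sphere_measure) = of_nat DIM('a) *
      (\<integral>\<^sup>+x. f (x /\<^sub>R norm x) \<partial>restrict_space lborel (cball 0 1 - {0}))"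
    unfolding borel_sphere_measure_def using fr
    by (simp add: nn_integral_scale_measure nn_integral_distr[OF radial_projection_measurable])
  also have "(\<integral>\<^sup>+x. f (x /\<^sub>R norm x) \<partial>restrict_space lborel (cball 0 1 - {0}))
      = (\<integral>\<^sup>+x. f (x /\<^sub>R norm x) * indicator (cball 0 1 - {0}) x \<partial>lborel)"
    by (intro nn_integral_restrict_space) auto
  finally show ?thesis .
qed

lemma sets_borel_sphere_measure:
  "sets borel_sphere_measure = sets (restrict_space borel (sphere (0::'a::euclidean_space) 1))"
  by (simp add: borel_sphere_measure_def)

text \<open>
  By definition of the surface measure, the points of the unit ball whose direction lies in a null set
  of the sphere form a null set. Dilations by the positive integers carry this to all balls around the origin.
\<close>

lemma AE_sphere_imp_AE_radial:
  assumes "AE \<theta> in borel_sphere_measure. P \<theta>"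
  shows "AE x in lborel. P (x /\<^sub>R norm (x::'a::euclidean_space))"
proof -
  obtain A where A: "{\<theta> \<in> space borel_sphere_measure. \<not> P \<theta>} \<subseteq> A" "A \<in> null_sets borel_sphere_measure"
    using assms by (auto simp: eventually_ae_filter)
  have sp: "space borel_sphere_measure = sphere (0::'a) 1"
    using sets_eq_imp_space_eq[OF sets_borel_sphere_measure] by (auto simp: space_restrict_space)
  have As: "A \<in> sets (restrict_space borel (sphere 0 1))"
    using A(2) by (auto simp: null_sets_def sets_borel_sphere_measure)
  then have Ab [measurable]: "A \<in> sets borel"
    by (auto simp: sets_restrict_space)
  define F where "F n x = (indicator {x. 0 < norm x \<and> norm x \<le> n \<and> x /\<^sub>R norm x \<in> A} x :: ennreal)"
    for n :: real and x :: 'a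
  have F [measurable]: "F n \<in> borel_measurable borel" for n
    unfolding F_def[abs_def] by measurable
  have F1: "(\<integral>\<^sup>+x. F 1 x \<partial>lborel) = 0"
  proof -
    have "of_nat DIM('a) * emeasure lborel {x::'a. 0 < norm x \<and> norm x \<le> 1 \<and> x /\<^sub>R norm x \<in> A} = 0"
      using A(2) emeasure_borel_sphere_measure[OF As] by (simp add: null_sets_def)
    then show ?thesis
      by (simp add: F_def[abs_def])
  qed
  have "AE x in lborel. F (Suc n) x = 0" for n
  proof -
    have scale: "F (real (Suc n)) (real (Suc n) *\<^sub>R x) = F 1 x" for x
    proof -
      have dir_eq: "(real (Suc n) *\<^sub>R x) /\<^sub>R norm (real (Suc n) *\<^sub>R x) = x /\<^sub>R norm x"
        by (simp add: field_simps del: of_nat_Suc)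
      have norm_eq: "norm (real (Suc n) *\<^sub>R x) = real (Suc n) * norm x"
        by simp
      show ?thesis
        by (simp only: F_def indicator_def mem_Collect_eq dir_eq)
           (simp only: norm_eq, simp add: zero_less_mult_iff del: of_nat_Suc)
    qed
    have "(\<integral>\<^sup>+x. F (Suc n) x \<partial>lborel)
        = ennreal (real (Suc n) ^ DIM('a)) * (\<integral>\<^sup>+x. F (Suc n) (real (Suc n) *\<^sub>R x) \<partial>lborel)"
      by (rule nn_integral_lborel_scale) auto
    then have "(\<integral>\<^sup>+x. F (Suc n) x \<partial>lborel) = 0"
      using F1 by (simp only: scale mult_zero_right)
    then show ?thesis
      by (subst (asm) nn_integral_0_iff_AE) auto
  qed
  then have "AE x in lborel. \<forall>n. F (Suc n) x = 0"
    by (simp add: AE_all_countable)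
  moreover have "AE x in lborel. x \<noteq> (0::'a)"
    by (rule AE_lborel_singleton)
  ultimately show ?thesis
  proof eventually_elim
    case (elim x)
    obtain n where "norm x \<le> real n"
      using real_arch_simple by blast
    then have "norm x \<le> real (Suc n)"
      by simp
    then have "x /\<^sub>R norm x \<notin> A"
      using elim(1)[THEN spec, of n] elim(2) by (auto simp: F_def indicator_def split: if_splits)
    moreover have "x /\<^sub>R norm x \<in> space borel_sphere_measure"
      using elim(2) by (simp add: sp)
    ultimately show ?case
      using A(1) by blast
  qed
qed

text \<open>
  These bounds make the height \<open>t\<close> in pyramid coordinates comparable to the norm of the point.
\<close>

lemma slice_norm_bounds:
  fixes b :: "'a::euclidean_space"
  assumes b: "b \<in> Basis" and \<sigma>: "\<sigma> = 1 \<or> \<sigma> = -1" and y: "y \<in> cube (Basis - {b})"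
  shows "1 \<le> norm (slice_point (\<sigma> *\<^sub>R b) (Basis - {b}) y)"
    and "norm (slice_point (\<sigma> *\<^sub>R b) (Basis - {b}) y) \<le> DIM('a)"
proof -
  let ?e = "slice_point (\<sigma> *\<^sub>R b) (Basis - {b}) y"
  have "\<bar>?e \<bullet> b\<bar> = 1"
    using b \<sigma> by (auto simp: slice_point_inner)
  then show "1 \<le> norm ?e"
    using Basis_le_norm[OF b, of ?e] by simp
  have "norm (\<sigma> *\<^sub>R b) = 1"
    using b \<sigma> by auto
  then show "norm ?e \<le> DIM('a)"
    using slice_point_cube_bound[of "Basis - {b}" y "\<sigma> *\<^sub>R b"] b y
    by (simp add: of_nat_diff)
qed

lemma powr_scaled_bounds:
  fixes \<gamma> c t N :: real
  assumes t: "0 < t" and c: "1 \<le> c" "c \<le> N"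
  shows "(t * c) powr \<gamma> \<le> N powr \<bar>\<gamma>\<bar> * t powr \<gamma>"
    and "t powr \<gamma> \<le> N powr \<bar>\<gamma>\<bar> * (t * c) powr \<gamma>"
proof -
  have "c powr \<gamma> \<le> c powr \<bar>\<gamma>\<bar>" "c powr - \<gamma> \<le> c powr \<bar>\<gamma>\<bar>" "c powr \<bar>\<gamma>\<bar> \<le> N powr \<bar>\<gamma>\<bar>"
    using c by (auto intro!: powr_mono powr_mono2)
  then have c': "c powr \<gamma> \<le> N powr \<bar>\<gamma>\<bar>" "c powr - \<gamma> \<le> N powr \<bar>\<gamma>\<bar>"
    by auto
  have tc: "(t * c) powr \<gamma> = t powr \<gamma> * c powr \<gamma>"
    using t c by (simp add: powr_mult)
  show "(t * c) powr \<gamma> \<le> N powr \<bar>\<gamma>\<bar> * t powr \<gamma>"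
    unfolding tc using mult_left_mono[OF c'(1), of "t powr \<gamma>"] by (simp add: mult.commute)
  have "t powr \<gamma> = c powr - \<gamma> * (t * c) powr \<gamma>"
    using t c by (simp add: tc powr_minus)
  also have "\<dots> \<le> N powr \<bar>\<gamma>\<bar> * (t * c) powr \<gamma>"
    by (intro mult_right_mono c') simp
  finally show "t powr \<gamma> \<le> N powr \<bar>\<gamma>\<bar> * (t * c) powr \<gamma>" .
qed

text \<open>
  The surface measure is \<open>N\<close> times the volume of the cone inside the unit ball. For \<open>t \<le> 1 / N\<close> the whole
  section of the pyramid at height \<open>t\<close> lies in the unit ball, and on all these sections the integrand
  depends only on \<open>y\<close>, because it is constant on rays.
\<close>

lemma nn_integral_cube_le_sphere:
  fixes b :: "'a::euclidean_space" and f :: "'a \<Rightarrow> ennreal"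
  assumes b: "b \<in> Basis" and \<sigma>: "\<sigma> = 1 \<or> \<sigma> = -1" and f [measurable]: "f \<in> borel_measurable borel"
  defines "e \<equiv> slice_point (\<sigma> *\<^sub>R b) (Basis - {b})"
  shows "(\<integral>\<^sup>+y. f (e y /\<^sub>R norm (e y)) \<partial>cube_measure (Basis - {b}))
    \<le> ennreal (real DIM('a) ^ DIM('a)) * (\<integral>\<^sup>+\<theta>. f \<theta> \<partial>borel_sphere_measure)"
proof -
  define n where "n = DIM('a)"
  have n: "0 < n" "DIM('a) = n"
    by (simp_all add: n_def)
  let ?C = "\<integral>\<^sup>+y. f (e y /\<^sub>R norm (e y)) \<partial>cube_measure (Basis - {b})"
  let ?F = "\<lambda>x. f (x /\<^sub>R norm x) * indicator (cball 0 1 - {0}) x"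
  have fin: "finite (Basis - {b})"
    by simp
  \<comment> \<open>The number \<open>1 / (n n\<^sup>n)\<close> is the integral of \<open>t\<^bsup>n - 1\<^esup>\<close> over \<open>[0, 1 / n]\<close>.\<close>
  have "ennreal (1 / (real n * real n ^ n)) * ?C
      = (\<integral>\<^sup>+t. ennreal (t powr real (n - 1)) * indicator {0..1 / real n} t * ?C \<partial>lborel)"
  proof -
    have "((\<lambda>t. t powr real (n - 1)) has_integral
        ((1 / real n) powr (real (n - 1) + 1) / (real (n - 1) + 1))) {0..1 / real n}"
      by (intro has_integral_powr_from_0) (auto intro: order_less_le_trans[of _ 0])
    moreover have "(1 / real n) powr (real (n - 1) + 1) / (real (n - 1) + 1) = 1 / (real n * real n ^ n)"
    proof -
      have "real (n - 1) + 1 = real n"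
        using n by simp
      then show ?thesis
        using n by (simp only: powr_realpow) (simp add: powr_realpow power_divide)
    qed
    ultimately have "(\<integral>\<^sup>+t. ennreal (t powr real (n - 1)) * indicator {0..1 / real n} t \<partial>lborel)
        = ennreal (1 / (real n * real n ^ n))"
      by (intro nn_integral_has_integral_lebesgue') auto
    then show ?thesis
      by (simp add: nn_integral_multc)
  qed
  also have "\<dots> \<le> (\<integral>\<^sup>+t. ennreal (t ^ (DIM('a) - 1)) * indicator {0<..} t *
        (\<integral>\<^sup>+y. ?F (t *\<^sub>R e y) \<partial>cube_measure (Basis - {b})) \<partial>lborel)"
  proof (rule nn_integral_mono_AE)
    have "AE t in lborel. t \<noteq> (0::real)"
      by (rule AE_lborel_singleton)
    then show "AE t in lborel. ennreal (t powr real (n - 1)) * indicator {0..1 / real n} t * ?C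
        \<le> ennreal (t ^ (DIM('a) - 1)) * indicator {0<..} t *
          (\<integral>\<^sup>+y. ?F (t *\<^sub>R e y) \<partial>cube_measure (Basis - {b}))"
    proof eventually_elim
      case (elim t)
      show ?case
      proof (cases "t \<in> {0..1 / real n}")
        case True
        with elim have t: "0 < t" "t * real n \<le> 1"
          using n by (auto simp: field_simps)
        have "?C \<le> (\<integral>\<^sup>+y. ?F (t *\<^sub>R e y) \<partial>cube_measure (Basis - {b}))"
        proof (rule nn_integral_cube_mono[OF fin])
          fix y assume y: "y \<in> cube (Basis - {b})"
          have ey: "1 \<le> norm (e y)" "norm (e y) \<le> real n"
            using slice_norm_bounds[OF b \<sigma> y] by (auto simp: e_def n)
          then have "t * norm (e y) \<le> t * real n"
            using t by (intro mult_left_mono) auto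
          with t(2) have "t * norm (e y) \<le> 1"
            by linarith
          then have "t *\<^sub>R e y \<in> cball 0 1 - {0}"
            using ey t by auto
          moreover have "(t *\<^sub>R e y) /\<^sub>R norm (t *\<^sub>R e y) = e y /\<^sub>R norm (e y)"
            using t by simp
          ultimately show "f (e y /\<^sub>R norm (e y)) \<le> ?F (t *\<^sub>R e y)"
            by (simp only: indicator_simps mult_1_right order_refl)
        qed
        then show ?thesis
          using t True by (simp add: n powr_realpow mult_left_mono)
      qed simp
    qed
  qed
  also have "\<dots> = (\<integral>\<^sup>+x. ?F x * indicator (pyramid (\<sigma> *\<^sub>R b)) x \<partial>lborel)"
  proof -
    have [measurable]: "cball 0 1 - {0::'a} \<in> sets borel"
      by (intro sets.Diff borel_closed) auto
    have "?F \<in> borel_measurable borel"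
      by (intro borel_measurable_times_ennreal borel_measurable_indicator) measurable
    then show ?thesis
      unfolding e_def by (rule nn_integral_pyramid[symmetric, OF b \<sigma>])
  qed
  also have "\<dots> \<le> (\<integral>\<^sup>+x. ?F x \<partial>lborel)"
    by (intro nn_integral_mono) (auto split: split_indicator)
  finally have "ennreal (real n * real n ^ n) * (ennreal (1 / (real n * real n ^ n)) * ?C)
      \<le> ennreal (real n * real n ^ n) * (\<integral>\<^sup>+x. ?F x \<partial>lborel)"
    by (rule mult_left_mono) simp
  moreover have "ennreal (real n * real n ^ n) * ennreal (1 / (real n * real n ^ n)) = 1"
    using n by (simp flip: ennreal_mult)
  moreover have "ennreal (real n * real n ^ n) * (\<integral>\<^sup>+x. ?F x \<partial>lborel)
      = ennreal (real DIM('a) ^ DIM('a)) * (\<integral>\<^sup>+\<theta>. f \<theta> \<partial>borel_sphere_measure)"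
    unfolding nn_integral_borel_sphere_measure[OF f] n
    by (simp add: ennreal_mult mult_ac ennreal_of_nat_eq_real_of_nat)
  ultimately show ?thesis
    by (simp flip: mult.assoc)
qed

section \<open>The weighted inequality on the whole space\<close>

lemma has_continuous_gradient_scale:
  fixes u :: "'a::euclidean_space \<Rightarrow> real"
  assumes "has_continuous_gradient u G"
  shows "has_continuous_gradient (\<lambda>x. u (t *\<^sub>R x)) (\<lambda>x. t *\<^sub>R G (t *\<^sub>R x))"
  unfolding has_continuous_gradient_def
proof (intro conjI allI)
  fix x :: 'a
  have "((\<lambda>x. t *\<^sub>R x) has_derivative (\<lambda>h. t *\<^sub>R h)) (at x)"
    by (auto intro!: derivative_eq_intros)
  from has_derivative_compose[OF this has_continuous_gradientD(1)[OF assms, of "t *\<^sub>R x"]]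
  show "((\<lambda>x. u (t *\<^sub>R x)) has_derivative (\<lambda>h. (t *\<^sub>R G (t *\<^sub>R x)) \<bullet> h)) (at x)"
    by simp
  show "continuous_on UNIV (\<lambda>x. t *\<^sub>R G (t *\<^sub>R x))"
    by (intro continuous_intros continuous_on_compose2[OF has_continuous_gradientD(2)[OF assms]]) auto
qed

text \<open>
  On the section at height \<open>t\<close> the inequality on the cube is applied to \<open>u (t x)\<close>, whose gradient is
  \<open>t G (t x)\<close>. The factor \<open>t\<^sup>p\<close> created by the gradient turns the weight \<open>t\<^bsup>- (p + \<alpha>)\<^esup>\<close> into
  \<open>t\<^bsup>- \<alpha>\<^esup>\<close>, while \<open>h (x / |x|)\<close> does not change with \<open>t\<close>, so that its norm is the same on all
  sections and comes out of the integral over \<open>t\<close>.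
\<close>

theorem nn_integral_pyramid_weighted:
  fixes p q \<alpha> :: real
  assumes dim: "2 \<le> DIM('a::euclidean_space)" and p: "1 < p"
    and q: "p < real DIM('a) - 1 \<and> q = (real DIM('a) - 1) / p \<or> p > real DIM('a) - 1 \<and> q = 1
      \<or> p = real DIM('a) - 1 \<and> q > 1"
  obtains K :: ennreal where "K < top"
    "\<And>(b::'a) \<sigma> u G h. b \<in> Basis \<Longrightarrow> \<sigma> = 1 \<or> \<sigma> = -1 \<Longrightarrow> has_continuous_gradient u G \<Longrightarrow> h \<in> borel_measurable borel \<Longrightarrow>
      (\<integral>\<^sup>+x. h (x /\<^sub>R norm x) * ennreal (norm x powr - (p + \<alpha>)) * ennreal \<bar>u x\<bar> epowr p
          * indicator (pyramid (\<sigma> *\<^sub>R b)) x \<partial>lborel)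
      \<le> K * (\<integral>\<^sup>+\<theta>. h \<theta> epowr q \<partial>borel_sphere_measure) epowr (1 / q) *
        (\<integral>\<^sup>+x. ennreal (norm x powr - (p + \<alpha>)) * ennreal \<bar>u x\<bar> epowr p
            + ennreal (norm x powr - \<alpha>) * ennreal (norm (G x)) epowr p \<partial>lborel)"
proof -
  define N where "N = real DIM('a)"
  have q': "p < real (DIM('a) - 1) \<and> q = real (DIM('a) - 1) / p \<or> real (DIM('a) - 1) < p \<and> q = 1
      \<or> p = real (DIM('a) - 1) \<and> 1 < q"
    using q dim by (simp add: of_nat_diff)
  have q0: "0 < q"
    using q p dim by auto
  obtain K where K: "0 < K"
    "\<And>a I (w :: 'a \<Rightarrow> real) G H.
      I \<subseteq> Basis \<Longrightarrow> card I = DIM('a) - 1 \<Longrightarrow> has_continuous_gradient w G \<Longrightarrow> H \<in> borel_measurable (cube_measure I) \<Longrightarrow>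
      (\<integral>\<^sup>+y. H y * ennreal \<bar>w (slice_point a I y)\<bar> epowr p \<partial>cube_measure I) \<le>
      ennreal K * (\<integral>\<^sup>+y. H y epowr q \<partial>cube_measure I) epowr (1 / q) *
      (\<integral>\<^sup>+y. ennreal (\<bar>w (slice_point a I y)\<bar> + norm (G (slice_point a I y))) epowr p \<partial>cube_measure I)"
    using weighted_Sobolev_cube[OF p q', where 'a='a] by blast
  define c1 where "c1 = N powr \<bar>- (p + \<alpha>)\<bar>"
  define c2 where "c2 = N powr \<bar>- (p + \<alpha>)\<bar> + N powr \<bar>- \<alpha>\<bar>"
  define K' where "K' = ennreal c1 * ennreal K * ennreal (real DIM('a) ^ DIM('a)) epowr (1 / q)
    * ennreal (2 powr p) * ennreal c2"
  show thesis
  proof (rule that[of K'])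
    show "K' < top"
      by (simp add: K'_def ennreal_mult_eq_top_iff flip: top.not_eq_extremum)
  next
    fix b :: 'a and \<sigma> :: real and u :: "'a \<Rightarrow> real" and G and h :: "'a \<Rightarrow> ennreal"
    assume b: "b \<in> Basis" and \<sigma>: "\<sigma> = 1 \<or> \<sigma> = -1" and uG: "has_continuous_gradient u G"
      and h [measurable]: "h \<in> borel_measurable borel"
    define I where "I = Basis - {b}"
    define e where "e = slice_point (\<sigma> *\<^sub>R b) I"
    have I: "finite I" "I \<subseteq> Basis" "card I = DIM('a) - 1"
      using b by (auto simp: I_def)
    have e: "1 \<le> norm (e y)" "norm (e y) \<le> N" if "y \<in> cube I" for y
      using slice_norm_bounds[OF b \<sigma>, of y] that by (auto simp: e_def I_def N_def)
    have [measurable]: "u \<in> borel_measurable borel" "G \<in> borel_measurable borel"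
      using has_continuous_gradientD(2,3)[OF uG] by (auto intro: borel_measurable_continuous_onI)
    have e_meas [measurable]: "e \<in> borel_measurable (\<Pi>\<^sub>M i\<in>I. lborel)"
      unfolding e_def by (rule measurable_slice_point[OF I(1)])
    let ?S = "(\<integral>\<^sup>+\<theta>. h \<theta> epowr q \<partial>borel_sphere_measure) epowr (1 / q)"
    let ?F = "\<lambda>x. h (x /\<^sub>R norm x) * ennreal (norm x powr - (p + \<alpha>)) * ennreal \<bar>u x\<bar> epowr p"
    let ?Z = "\<lambda>x. ennreal (norm x powr - (p + \<alpha>)) * ennreal \<bar>u x\<bar> epowr p
            + ennreal (norm x powr - \<alpha>) * ennreal (norm (G x)) epowr p"
    have slice: "(\<integral>\<^sup>+y. ?F (t *\<^sub>R e y) \<partial>cube_measure I) \<le> K' * ?S * (\<integral>\<^sup>+y. ?Z (t *\<^sub>R e y) \<partial>cube_measure I)"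
      if t: "0 < t" for t
    proof -
      let ?H = "\<lambda>y. h (e y /\<^sub>R norm (e y))"
      let ?D = "\<lambda>y. ennreal (\<bar>u (t *\<^sub>R e y)\<bar> + norm (t *\<^sub>R G (t *\<^sub>R e y)))"
      have "(\<integral>\<^sup>+y. ?F (t *\<^sub>R e y) \<partial>cube_measure I)
          \<le> (\<integral>\<^sup>+y. (ennreal c1 * ennreal (t powr - (p + \<alpha>))) * (?H y * ennreal \<bar>u (t *\<^sub>R e y)\<bar> epowr p) \<partial>cube_measure I)"
      proof (rule nn_integral_cube_mono[OF I(1)])
        fix y assume "y \<in> cube I"
        then have "(t * norm (e y)) powr - (p + \<alpha>) \<le> c1 * t powr - (p + \<alpha>)"
          unfolding c1_def by (intro powr_scaled_bounds t e)
        then have "ennreal (norm (t *\<^sub>R e y) powr - (p + \<alpha>)) \<le> ennreal c1 * ennreal (t powr - (p + \<alpha>))"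
          using t by (subst ennreal_mult[symmetric]) (auto simp: c1_def intro!: ennreal_leI)
        then have "?H y * ennreal (norm (t *\<^sub>R e y) powr - (p + \<alpha>)) * ennreal \<bar>u (t *\<^sub>R e y)\<bar> epowr p
            \<le> ?H y * (ennreal c1 * ennreal (t powr - (p + \<alpha>))) * ennreal \<bar>u (t *\<^sub>R e y)\<bar> epowr p"
          by (intro mult_right_mono mult_left_mono) auto
        moreover have "(t *\<^sub>R e y) /\<^sub>R norm (t *\<^sub>R e y) = e y /\<^sub>R norm (e y)"
          using t by simp
        ultimately show "?F (t *\<^sub>R e y)
            \<le> (ennreal c1 * ennreal (t powr - (p + \<alpha>))) * (?H y * ennreal \<bar>u (t *\<^sub>R e y)\<bar> epowr p)"
          by (simp only: mult_ac)
      qed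
      also have "\<dots> = (ennreal c1 * ennreal (t powr - (p + \<alpha>))) *
          (\<integral>\<^sup>+y. ?H y * ennreal \<bar>u (t *\<^sub>R e y)\<bar> epowr p \<partial>cube_measure I)"
        by (intro nn_integral_cmult) measurable
      also have "(\<integral>\<^sup>+y. ?H y * ennreal \<bar>u (t *\<^sub>R e y)\<bar> epowr p \<partial>cube_measure I)
          \<le> ennreal K * (\<integral>\<^sup>+y. ?H y epowr q \<partial>cube_measure I) epowr (1 / q) * (\<integral>\<^sup>+y. ?D y epowr p \<partial>cube_measure I)"
        unfolding e_def by (intro K(2) I has_continuous_gradient_scale uG) (unfold e_def[symmetric], measurable)
      also have "\<dots> \<le> ennreal K * (ennreal (real DIM('a) ^ DIM('a)) epowr (1 / q) * ?S) *
          (\<integral>\<^sup>+y. ennreal (2 powr p) * (ennreal \<bar>u (t *\<^sub>R e y)\<bar> epowr p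
            + ennreal (norm (t *\<^sub>R G (t *\<^sub>R e y))) epowr p) \<partial>cube_measure I)"
      proof (intro mult_mono nn_integral_mono)
        have "(\<integral>\<^sup>+y. ?H y epowr q \<partial>cube_measure I)
            \<le> ennreal (real DIM('a) ^ DIM('a)) * (\<integral>\<^sup>+\<theta>. h \<theta> epowr q \<partial>borel_sphere_measure)"
          unfolding e_def I_def by (rule nn_integral_cube_le_sphere[OF b \<sigma>]) measurable
        then show "(\<integral>\<^sup>+y. ?H y epowr q \<partial>cube_measure I) epowr (1 / q)
            \<le> ennreal (real DIM('a) ^ DIM('a)) epowr (1 / q) * ?S"
          unfolding epowr_mult[symmetric] using q0 by (intro epowr_mono) auto
        show "?D y epowr p \<le> ennreal (2 powr p) * (ennreal \<bar>u (t *\<^sub>R e y)\<bar> epowr p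
            + ennreal (norm (t *\<^sub>R G (t *\<^sub>R e y))) epowr p)" for y
          using p by (subst ennreal_plus) (auto intro!: epowr_sum_le)
      qed auto
      also have "(\<integral>\<^sup>+y. ennreal (2 powr p) * (ennreal \<bar>u (t *\<^sub>R e y)\<bar> epowr p
            + ennreal (norm (t *\<^sub>R G (t *\<^sub>R e y))) epowr p) \<partial>cube_measure I)
          = ennreal (2 powr p) * (\<integral>\<^sup>+y. ennreal \<bar>u (t *\<^sub>R e y)\<bar> epowr p
            + ennreal (norm (t *\<^sub>R G (t *\<^sub>R e y))) epowr p \<partial>cube_measure I)"
        by (intro nn_integral_cmult) measurable
      finally have "(\<integral>\<^sup>+y. ?F (t *\<^sub>R e y) \<partial>cube_measure I)
          \<le> (ennreal c1 * ennreal (t powr - (p + \<alpha>))) * (ennreal K * (ennreal (real DIM('a) ^ DIM('a)) epowr (1 / q) * ?S) *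
            (ennreal (2 powr p) * (\<integral>\<^sup>+y. ennreal \<bar>u (t *\<^sub>R e y)\<bar> epowr p
            + ennreal (norm (t *\<^sub>R G (t *\<^sub>R e y))) epowr p \<partial>cube_measure I)))"
        by (simp add: mult_left_mono)
      also have "\<dots> = (ennreal c1 * ennreal K * ennreal (real DIM('a) ^ DIM('a)) epowr (1 / q) * ennreal (2 powr p)) * ?S *
            (ennreal (t powr - (p + \<alpha>)) * (\<integral>\<^sup>+y. ennreal \<bar>u (t *\<^sub>R e y)\<bar> epowr p
            + ennreal (norm (t *\<^sub>R G (t *\<^sub>R e y))) epowr p \<partial>cube_measure I))"
        by (simp only: mult_ac)
      also have "ennreal (t powr - (p + \<alpha>)) * (\<integral>\<^sup>+y. ennreal \<bar>u (t *\<^sub>R e y)\<bar> epowr p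
            + ennreal (norm (t *\<^sub>R G (t *\<^sub>R e y))) epowr p \<partial>cube_measure I)
          = (\<integral>\<^sup>+y. ennreal (t powr - (p + \<alpha>)) * (ennreal \<bar>u (t *\<^sub>R e y)\<bar> epowr p
            + ennreal (norm (t *\<^sub>R G (t *\<^sub>R e y))) epowr p) \<partial>cube_measure I)"
        by (intro nn_integral_cmult[symmetric]) measurable
      also have "\<dots> \<le> (\<integral>\<^sup>+y. ennreal c2 * ?Z (t *\<^sub>R e y) \<partial>cube_measure I)"
      proof (rule nn_integral_cube_mono[OF I(1)])
        fix y assume y: "y \<in> cube I"
        have grad: "ennreal (t powr - (p + \<alpha>)) * ennreal (norm (t *\<^sub>R G (t *\<^sub>R e y))) epowr p
            = ennreal (t powr - \<alpha>) * ennreal (norm (G (t *\<^sub>R e y))) epowr p"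
        proof -
          have "t powr - (p + \<alpha>) * (t * norm (G (t *\<^sub>R e y))) powr p
              = t powr - \<alpha> * norm (G (t *\<^sub>R e y)) powr p"
            using t by (simp add: powr_mult flip: powr_add mult.assoc)
          then show ?thesis
            using t by (simp add: ennreal_epowr flip: ennreal_mult)
        qed
        have "t powr - (p + \<alpha>) \<le> c2 * (t * norm (e y)) powr - (p + \<alpha>)"
          using powr_scaled_bounds(2)[OF t e[OF y], of "- (p + \<alpha>)"]
          by (rule order_trans) (auto simp: c2_def intro!: mult_right_mono)
        then have 1: "ennreal (t powr - (p + \<alpha>)) \<le> ennreal c2 * ennreal (norm (t *\<^sub>R e y) powr - (p + \<alpha>))"
          using t by (subst ennreal_mult[symmetric]) (auto simp: c2_def intro!: ennreal_leI)
        have "t powr - \<alpha> \<le> c2 * (t * norm (e y)) powr - \<alpha>"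
          using powr_scaled_bounds(2)[OF t e[OF y], of "- \<alpha>"]
          by (rule order_trans) (auto simp: c2_def intro!: mult_right_mono)
        then have 2: "ennreal (t powr - \<alpha>) \<le> ennreal c2 * ennreal (norm (t *\<^sub>R e y) powr - \<alpha>)"
          using t by (subst ennreal_mult[symmetric]) (auto simp: c2_def intro!: ennreal_leI)
        show "ennreal (t powr - (p + \<alpha>)) * (ennreal \<bar>u (t *\<^sub>R e y)\<bar> epowr p
            + ennreal (norm (t *\<^sub>R G (t *\<^sub>R e y))) epowr p) \<le> ennreal c2 * ?Z (t *\<^sub>R e y)"
          unfolding distrib_left grad mult.assoc[symmetric] by (intro add_mono mult_right_mono 1 2) auto
      qed
      also have "\<dots> = ennreal c2 * (\<integral>\<^sup>+y. ?Z (t *\<^sub>R e y) \<partial>cube_measure I)"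
        by (intro nn_integral_cmult) measurable
      finally have "(\<integral>\<^sup>+y. ?F (t *\<^sub>R e y) \<partial>cube_measure I)
          \<le> (ennreal c1 * ennreal K * ennreal (real DIM('a) ^ DIM('a)) epowr (1 / q) * ennreal (2 powr p)) * ?S *
            (ennreal c2 * (\<integral>\<^sup>+y. ?Z (t *\<^sub>R e y) \<partial>cube_measure I))"
        by (simp add: mult_left_mono)
      also have "\<dots> = K' * ?S * (\<integral>\<^sup>+y. ?Z (t *\<^sub>R e y) \<partial>cube_measure I)"
        unfolding K'_def by (simp only: mult_ac)
      finally show ?thesis .
    qed
    have "(\<integral>\<^sup>+x. ?F x * indicator (pyramid (\<sigma> *\<^sub>R b)) x \<partial>lborel)
        = (\<integral>\<^sup>+t. ennreal (t ^ (DIM('a) - 1)) * indicator {0<..} t *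
            (\<integral>\<^sup>+y. ?F (t *\<^sub>R e y) \<partial>cube_measure I) \<partial>lborel)"
      unfolding e_def I_def by (rule nn_integral_pyramid[OF b \<sigma>]) measurable
    also have "\<dots> \<le> (\<integral>\<^sup>+t. ennreal (t ^ (DIM('a) - 1)) * indicator {0<..} t *
            (K' * ?S * (\<integral>\<^sup>+y. ?Z (t *\<^sub>R e y) \<partial>cube_measure I)) \<partial>lborel)"
      using slice by (intro nn_integral_mono) (auto split: split_indicator intro!: mult_left_mono)
    also have "\<dots> = (\<integral>\<^sup>+t. K' * ?S * (ennreal (t ^ (DIM('a) - 1)) * indicator {0<..} t *
            (\<integral>\<^sup>+y. ?Z (t *\<^sub>R e y) \<partial>cube_measure I)) \<partial>lborel)"
      by (intro nn_integral_cong) (simp only: mult_ac)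
    also have "\<dots> = K' * ?S * (\<integral>\<^sup>+t. ennreal (t ^ (DIM('a) - 1)) * indicator {0<..} t *
            (\<integral>\<^sup>+y. ?Z (t *\<^sub>R e y) \<partial>cube_measure I) \<partial>lborel)"
    proof (rule nn_integral_cmult)
      interpret C: finite_measure "cube_measure I"
        by standard (simp add: emeasure_cube_measure_space[OF I(1)] power_eq_top_ennreal)
      have "(\<lambda>t. \<integral>\<^sup>+y. ?Z (t *\<^sub>R e y) \<partial>cube_measure I) \<in> borel_measurable lborel"
        by (rule C.borel_measurable_nn_integral) measurable
      then show "(\<lambda>t. ennreal (t ^ (DIM('a) - 1)) * indicator {0<..} t *
            (\<integral>\<^sup>+y. ?Z (t *\<^sub>R e y) \<partial>cube_measure I)) \<in> borel_measurable lborel"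
        by measurable
    qed
    also have "(\<integral>\<^sup>+t. ennreal (t ^ (DIM('a) - 1)) * indicator {0<..} t *
            (\<integral>\<^sup>+y. ?Z (t *\<^sub>R e y) \<partial>cube_measure I) \<partial>lborel)
        = (\<integral>\<^sup>+x. ?Z x * indicator (pyramid (\<sigma> *\<^sub>R b)) x \<partial>lborel)"
      unfolding e_def I_def by (rule nn_integral_pyramid[OF b \<sigma>, symmetric]) measurable
    also have "\<dots> \<le> (\<integral>\<^sup>+x. ?Z x \<partial>lborel)"
      by (intro nn_integral_mono) (auto split: split_indicator)
    finally show "(\<integral>\<^sup>+x. ?F x * indicator (pyramid (\<sigma> *\<^sub>R b)) x \<partial>lborel) \<le> K' * ?S * (\<integral>\<^sup>+x. ?Z x \<partial>lborel)"
      by (simp add: mult_left_mono)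
  qed
qed

text \<open>
  The estimates on the \<open>2N\<close> pyramids are added, and the Hardy inequality removes the term without
  derivatives.
\<close>

theorem nn_integral_weighted_Hardy:
  fixes p q \<alpha> :: real
  assumes dim: "2 \<le> DIM('a::euclidean_space)" and p: "1 < p" and \<alpha>: "p + \<alpha> < real DIM('a)"
    and q: "p < real DIM('a) - 1 \<and> q = (real DIM('a) - 1) / p \<or> p > real DIM('a) - 1 \<and> q = 1
      \<or> p = real DIM('a) - 1 \<and> q > 1"
  obtains K :: ennreal where "K < top"
    "\<And>(u::'a \<Rightarrow> real) G h R. has_continuous_gradient u G \<Longrightarrow> (\<And>x. R < norm x \<Longrightarrow> u x = 0) \<Longrightarrow> h \<in> borel_measurable borel \<Longrightarrow>
      (\<integral>\<^sup>+x. h (x /\<^sub>R norm x) * ennreal (norm x powr - (p + \<alpha>)) * ennreal \<bar>u x\<bar> epowr p \<partial>lborel)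
      \<le> K * (\<integral>\<^sup>+\<theta>. h \<theta> epowr q \<partial>borel_sphere_measure) epowr (1 / q) *
        (\<integral>\<^sup>+x. ennreal (norm x powr - \<alpha>) * ennreal (norm (G x)) epowr p \<partial>lborel)"
proof -
  obtain K where K: "K < top"
    "\<And>(b::'a) \<sigma> u G h. b \<in> Basis \<Longrightarrow> \<sigma> = 1 \<or> \<sigma> = -1 \<Longrightarrow> has_continuous_gradient u G \<Longrightarrow> h \<in> borel_measurable borel \<Longrightarrow>
      (\<integral>\<^sup>+x. h (x /\<^sub>R norm x) * ennreal (norm x powr - (p + \<alpha>)) * ennreal \<bar>u x\<bar> epowr p
          * indicator (pyramid (\<sigma> *\<^sub>R b)) x \<partial>lborel)
      \<le> K * (\<integral>\<^sup>+\<theta>. h \<theta> epowr q \<partial>borel_sphere_measure) epowr (1 / q) *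
        (\<integral>\<^sup>+x. ennreal (norm x powr - (p + \<alpha>)) * ennreal \<bar>u x\<bar> epowr p
            + ennreal (norm x powr - \<alpha>) * ennreal (norm (G x)) epowr p \<partial>lborel)"
    using nn_integral_pyramid_weighted[OF dim p q] by blast
  define \<gamma> where "\<gamma> = (p + real DIM('a) - \<alpha> - 2) / 2"
  define KH where "KH = (1 / (\<gamma> / (p - 1) - 1)) powr (p - 1) * (1 / (real DIM('a) - \<alpha> - \<gamma> - 1))"
  define K' where "K' = of_nat (2 * DIM('a)) * (K * (ennreal KH + 1))"
  show thesis
  proof (rule that[of K'])
    show "K' < top"
      using K(1) by (simp add: K'_def ennreal_mult_less_top of_nat_less_top)
  next
    fix u :: "'a \<Rightarrow> real" and G and h :: "'a \<Rightarrow> ennreal" and R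
    assume uG: "has_continuous_gradient u G" and supp: "\<And>x. R < norm x \<Longrightarrow> u x = 0"
      and h [measurable]: "h \<in> borel_measurable borel"
    have [measurable]: "u \<in> borel_measurable borel" "G \<in> borel_measurable borel"
      using has_continuous_gradientD(2,3)[OF uG] by (auto intro: borel_measurable_continuous_onI)
    let ?S = "(\<integral>\<^sup>+\<theta>. h \<theta> epowr q \<partial>borel_sphere_measure) epowr (1 / q)"
    let ?F = "\<lambda>x. h (x /\<^sub>R norm x) * ennreal (norm x powr - (p + \<alpha>)) * ennreal \<bar>u x\<bar> epowr p"
    let ?J = "\<integral>\<^sup>+x. ennreal (norm x powr - \<alpha>) * ennreal (norm (G x)) epowr p \<partial>lborel"
    let ?Z = "\<integral>\<^sup>+x. ennreal (norm x powr - (p + \<alpha>)) * ennreal \<bar>u x\<bar> epowr p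
            + ennreal (norm x powr - \<alpha>) * ennreal (norm (G x)) epowr p \<partial>lborel"
    have "?Z = (\<integral>\<^sup>+x. ennreal (norm x powr - (p + \<alpha>)) * ennreal \<bar>u x\<bar> epowr p \<partial>lborel) + ?J"
      by (intro nn_integral_add) measurable
    also have "\<dots> \<le> ennreal KH * ?J + ?J"
      unfolding KH_def \<gamma>_def by (intro add_right_mono Hardy_inequality[OF p \<alpha> uG supp])
    finally have Z: "?Z \<le> (ennreal KH + 1) * ?J"
      by (simp add: distrib_right)
    have "(\<integral>\<^sup>+x. ?F x \<partial>lborel)
        \<le> (\<Sum>b\<in>Basis. \<Sum>\<sigma>\<in>{1, -1}. \<integral>\<^sup>+x. ?F x * indicator (pyramid (\<sigma> *\<^sub>R b)) x \<partial>lborel)"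
      by (intro nn_integral_le_sum_pyramids) measurable
    also have "\<dots> \<le> (\<Sum>b\<in>(Basis::'a set). \<Sum>\<sigma>\<in>{1, -1::real}. K * ?S * ?Z)"
      by (intro sum_mono K(2) uG h) auto
    also have "\<dots> = of_nat (2 * DIM('a)) * (K * ?S * ?Z)"
      by (simp add: mult.assoc mult.left_commute)
    also have "\<dots> \<le> of_nat (2 * DIM('a)) * (K * ?S * ((ennreal KH + 1) * ?J))"
      by (intro mult_left_mono Z) auto
    also have "\<dots> = K' * ?S * ?J"
      unfolding K'_def by (simp only: mult_ac)
    finally show "(\<integral>\<^sup>+x. ?F x \<partial>lborel) \<le> K' * ?S * ?J" .
  qed
qed

section \<open>Smooth functions and passage to Lebesgue integrals\<close>

text \<open>
  In pyramid coordinates the integrand is comparable to \<open>t\<^bsup>N - 1 - \<alpha>\<^esup>\<close> with \<open>t\<close> bounded.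
\<close>

lemma nn_integral_powr_norm_ball_finite:
  fixes \<alpha> R :: real
  assumes \<alpha>: "\<alpha> < real DIM('a::euclidean_space)"
  shows "(\<integral>\<^sup>+x. ennreal (norm (x::'a) powr - \<alpha>) * indicator (cball 0 R) x \<partial>lborel) < top"
proof -
  define n where "n = DIM('a)"
  have n: "DIM('a) = n" "0 < n"
    by (simp_all add: n_def)
  define T where "T = max 0 R"
  define c where "c = real n powr \<bar>- \<alpha>\<bar>"
  let ?F = "\<lambda>x::'a. ennreal (norm x powr - \<alpha>) * indicator (cball 0 R) x"
  have F: "?F \<in> borel_measurable borel"
    by (intro borel_measurable_times_ennreal borel_measurable_indicator) auto
  have finite_pyramid: "(\<integral>\<^sup>+x. ?F x * indicator (pyramid (\<sigma> *\<^sub>R b)) x \<partial>lborel) < top"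
    if b: "b \<in> Basis" and "\<sigma> \<in> {1, -1::real}" for b :: 'a and \<sigma>
  proof -
    have \<sigma>: "\<sigma> = 1 \<or> \<sigma> = -1"
      using that by auto
    have fin: "finite (Basis - {b})"
      by simp
    let ?e = "slice_point (\<sigma> *\<^sub>R b) (Basis - {b})"
    let ?c = "ennreal c * 2 ^ card (Basis - {b})"
    have "(\<integral>\<^sup>+x. ?F x * indicator (pyramid (\<sigma> *\<^sub>R b)) x \<partial>lborel)
        = (\<integral>\<^sup>+t. ennreal (t ^ (DIM('a) - 1)) * indicator {0<..} t *
            (\<integral>\<^sup>+y. ?F (t *\<^sub>R ?e y) \<partial>cube_measure (Basis - {b})) \<partial>lborel)"
      by (rule nn_integral_pyramid[OF b \<sigma> F])
    also have "\<dots> \<le> (\<integral>\<^sup>+t. (ennreal (t powr (real n - 1 - \<alpha>)) * indicator {0..T} t) * ?c \<partial>lborel)"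
    proof (rule nn_integral_mono)
      fix t :: real
      show "ennreal (t ^ (DIM('a) - 1)) * indicator {0<..} t *
            (\<integral>\<^sup>+y. ?F (t *\<^sub>R ?e y) \<partial>cube_measure (Basis - {b}))
          \<le> (ennreal (t powr (real n - 1 - \<alpha>)) * indicator {0..T} t) * ?c"
      proof (cases "0 < t")
        case True
        have "(\<integral>\<^sup>+y. ?F (t *\<^sub>R ?e y) \<partial>cube_measure (Basis - {b}))
            \<le> (\<integral>\<^sup>+y. ennreal (c * t powr - \<alpha>) * indicator {0..T} t \<partial>cube_measure (Basis - {b}))"
        proof (rule nn_integral_cube_mono[OF fin])
          fix y assume y: "y \<in> cube (Basis - {b})"
          have e: "1 \<le> norm (?e y)" "norm (?e y) \<le> real n"
            using slice_norm_bounds[OF b \<sigma> y] by (simp_all add: n)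
          have "(t * norm (?e y)) powr - \<alpha> \<le> c * t powr - \<alpha>"
            unfolding c_def by (rule powr_scaled_bounds[OF True e])
          moreover have "t \<in> {0..T}" if "norm (t *\<^sub>R ?e y) \<le> R"
          proof -
            have "t \<le> t * norm (?e y)"
              using e True by simp
            also have "\<dots> \<le> T"
              using that True by (simp add: T_def)
            finally show ?thesis
              using True by simp
          qed
          ultimately show "?F (t *\<^sub>R ?e y) \<le> ennreal (c * t powr - \<alpha>) * indicator {0..T} t"
            using True by (auto intro!: mult_mono ennreal_leI split: split_indicator)
        qed
        also have "\<dots> = ennreal (c * t powr - \<alpha>) * indicator {0..T} t * 2 ^ card (Basis - {b})"
          by (simp add: emeasure_cube_measure_space[OF fin])
        finally have "ennreal (t ^ (DIM('a) - 1)) * (\<integral>\<^sup>+y. ?F (t *\<^sub>R ?e y) \<partial>cube_measure (Basis - {b}))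
            \<le> ennreal (t ^ (DIM('a) - 1)) * (ennreal (c * t powr - \<alpha>) * indicator {0..T} t * 2 ^ card (Basis - {b}))"
          by (rule mult_left_mono) simp
        also have "ennreal (t ^ (DIM('a) - 1)) * (ennreal (c * t powr - \<alpha>) * indicator {0..T} t * 2 ^ card (Basis - {b}))
            = (ennreal (t ^ (DIM('a) - 1)) * ennreal (t powr - \<alpha>)) * indicator {0..T} t * ?c"
          by (simp add: c_def ennreal_mult mult_ac)
        also have "ennreal (t ^ (DIM('a) - 1)) * ennreal (t powr - \<alpha>) = ennreal (t powr (real n - 1 - \<alpha>))"
        proof -
          have "t ^ (n - 1) * t powr - \<alpha> = t powr (real (n - 1) - \<alpha>)"
            using True by (simp add: powr_diff powr_minus powr_realpow field_simps)
          then show ?thesis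
            using n True by (simp add: of_nat_diff flip: ennreal_mult)
        qed
        finally show ?thesis
          using True by simp
      qed simp
    qed
    also have "\<dots> = (\<integral>\<^sup>+t. ennreal (t powr (real n - 1 - \<alpha>)) * indicator {0..T} t \<partial>lborel) * ?c"
      by (intro nn_integral_multc) measurable
    also have "(\<integral>\<^sup>+t. ennreal (t powr (real n - 1 - \<alpha>)) * indicator {0..T} t \<partial>lborel)
        = ennreal (T powr (real n - 1 - \<alpha> + 1) / (real n - 1 - \<alpha> + 1))"
      using \<alpha> by (intro nn_integral_has_integral_lebesgue' has_integral_powr_from_0) (auto simp: n T_def)
    also have "\<dots> * ?c < top"
      by (simp add: ennreal_mult_less_top power_less_top_ennreal)
    finally show ?thesis .
  qed
  have "(\<Sum>b\<in>(Basis::'a set). \<Sum>\<sigma>\<in>{1, -1}. \<integral>\<^sup>+x. ?F x * indicator (pyramid (\<sigma> *\<^sub>R b)) x \<partial>lborel) < top"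
    by (simp only: ennreal_sum_less_top finite_Basis finite.intros) (use finite_pyramid in blast)
  with nn_integral_le_sum_pyramids[OF F] show ?thesis
    by (rule order_le_less_trans)
qed

lemma smooth_has_continuous_gradient:
  fixes u :: "'a::euclidean_space \<Rightarrow> real"
  assumes "C_k (Suc 0) u"
  shows "has_continuous_gradient u (gradient u)"
proof -
  let ?D = "\<lambda>x. \<Sum>b\<in>Basis. frechet_derivative u (at x) b *\<^sub>R b"
  have D: "(u has_derivative (\<lambda>h. ?D x \<bullet> h)) (at x)" for x
  proof -
    have d: "(u has_derivative frechet_derivative u (at x)) (at x)"
      using assms by (intro iffD1[OF frechet_derivative_works]) simp
    have "frechet_derivative u (at x) h = ?D x \<bullet> h" for h
    proof -
      interpret L: linear "frechet_derivative u (at x)"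
        using d has_derivative_linear by blast
      have "frechet_derivative u (at x) h = frechet_derivative u (at x) (\<Sum>b\<in>Basis. (h \<bullet> b) *\<^sub>R b)"
        by (simp add: euclidean_representation)
      also have "\<dots> = (\<Sum>b\<in>Basis. (h \<bullet> b) * frechet_derivative u (at x) b)"
        by (simp add: L.sum L.scaleR)
      also have "\<dots> = ?D x \<bullet> h"
        unfolding inner_sum_left
        by (intro sum.cong refl) (simp only: inner_scaleR_left inner_commute[of h] mult.commute)
      finally show ?thesis .
    qed
    then show ?thesis
      by (intro has_derivative_eq_rhs[OF d] ext)
  qed
  have G: "gradient u x = ?D x" for x
    unfolding gradient_def
  proof (rule the_equality)
    show "GDERIV u x :> ?D x"
      unfolding gderiv_def by (subst inner_commute) (rule D)
    fix E assume "GDERIV u x :> E"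
    then have "(u has_derivative (\<lambda>h. E \<bullet> h)) (at x)"
      unfolding gderiv_def by (subst inner_commute)
    from has_derivative_unique[OF this D[of x]] have "E \<bullet> h = ?D x \<bullet> h" for h
      by (rule fun_cong)
    then show "E = ?D x"
      by (rule euclidean_eqI)
  qed
  have "continuous_on UNIV ?D"
    using assms by (intro continuous_on_sum continuous_on_scaleR continuous_on_const) auto
  moreover have "gradient u = ?D"
    by (rule ext) (rule G)
  ultimately have "continuous_on UNIV (gradient u)"
    by simp
  then show ?thesis
    unfolding has_continuous_gradient_def G using D by blast
qed

lemma has_continuous_gradient_zero_outside:
  assumes uG: "has_continuous_gradient u G" and supp: "\<And>x. R < norm x \<Longrightarrow> u x = 0" and x: "R < norm x"
  shows "G x = 0"
proof -
  have "open {x::'a. R < norm x}"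
    by (intro open_Collect_less continuous_intros)
  then have "(u has_derivative (\<lambda>h. 0)) (at x)"
    using x supp
    by (intro has_derivative_transform_within_open[OF has_derivative_const[of 0], of "{x. R < norm x}"]) auto
  from has_derivative_unique[OF this has_continuous_gradientD(1)[OF uG]]
  have "0 = G x \<bullet> G x"
    by (rule fun_cong)
  then show ?thesis
    by simp
qed

text \<open>
  The surface measure is complete, so \<open>g\<close> is Borel only up to a null set of directions. Replacing it by
  a Borel function keeps its norm and changes \<open>g (x / |x|)\<close> only on a null set of the whole space.
\<close>

lemma Lq_sphere_borel_representative:
  fixes g :: "'a::euclidean_space \<Rightarrow> real"
  assumes g: "Lq_sphere q g" and q: "0 < q"
  obtains k :: "'a \<Rightarrow> real" where "k \<in> borel_measurable borel"
    "AE x in lborel. g (x /\<^sub>R norm x) = k (x /\<^sub>R norm x)"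
    "(\<integral>\<^sup>+\<theta>. ennreal \<bar>k \<theta>\<bar> epowr q \<partial>borel_sphere_measure) epowr (1 / q) = ennreal (Lq_sphere_norm q g)"
proof -
  let ?S = "borel_sphere_measure :: 'a measure"
  have g_meas: "g \<in> borel_measurable (completion ?S)"
    and g_int: "integrable (completion ?S) (\<lambda>\<theta>. \<bar>g \<theta>\<bar> powr q)"
    using g by (auto simp: Lq_sphere_def sphere_measure_def)
  obtain g' where g': "g' \<in> borel_measurable ?S" "AE \<theta> in ?S. g \<theta> = g' \<theta>"
    using completion_ex_borel_measurable_real[OF g_meas] by blast
  \<comment> \<open>A Borel function on the whole space; the value \<open>0\<close> off the sphere matters only at \<open>x = 0\<close>.\<close>
  define k where "k \<theta> = indicator (sphere 0 1) \<theta> *\<^sub>R g' \<theta>" for \<theta>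
  have "g' \<in> borel_measurable (restrict_space borel (sphere 0 1))"
    using g'(1) by (simp add: measurable_cong_sets[OF sets_borel_sphere_measure refl])
  then have k: "k \<in> borel_measurable borel"
    unfolding k_def by (subst (asm) borel_measurable_restrict_space_iff) (auto simp: mult.commute)
  have sp: "space ?S = sphere 0 1"
    using sets_eq_imp_space_eq[OF sets_borel_sphere_measure] by (auto simp: space_restrict_space)
  have gk: "AE \<theta> in ?S. g \<theta> = k \<theta>"
    using g'(2) AE_space by eventually_elim (simp add: k_def sp)
  have "(\<integral>\<^sup>+\<theta>. ennreal \<bar>k \<theta>\<bar> epowr q \<partial>?S) = (\<integral>\<^sup>+\<theta>. ennreal (\<bar>g \<theta>\<bar> powr q) \<partial>?S)"
    using gk by (intro nn_integral_cong_AE) (auto simp: ennreal_epowr elim: eventually_mono)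
  also have "\<dots> = (\<integral>\<^sup>+\<theta>. ennreal (\<bar>g \<theta>\<bar> powr q) \<partial>completion ?S)"
    by (simp add: nn_integral_completion)
  also have "\<dots> = ennreal (LINT \<theta>|completion ?S. \<bar>g \<theta>\<bar> powr q)"
    by (intro nn_integral_eq_integral g_int) auto
  finally have "(\<integral>\<^sup>+\<theta>. ennreal \<bar>k \<theta>\<bar> epowr q \<partial>?S) epowr (1 / q) = ennreal (Lq_sphere_norm q g)"
    by (simp add: ennreal_epowr Lq_sphere_norm_def sphere_measure_def)
  with k AE_sphere_imp_AE_radial[OF gk] show thesis
    by (rule that)
qed

lemma integrable_gradient_powr:
  fixes u :: "'a::euclidean_space \<Rightarrow> real"
  assumes uG: "has_continuous_gradient u G" and supp: "\<And>x. R < norm x \<Longrightarrow> u x = 0"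
    and p: "0 < p" and \<alpha>: "\<alpha> < real DIM('a)"
  shows "integrable lebesgue (\<lambda>x. norm (G x) powr p / norm x powr \<alpha>)"
proof -
  have [measurable]: "G \<in> borel_measurable borel"
    using has_continuous_gradientD(2)[OF uG] by (rule borel_measurable_continuous_onI)
  have "compact (G ` cball 0 R)"
    by (intro compact_continuous_image continuous_on_subset[OF has_continuous_gradientD(2)[OF uG]]) auto
  then obtain B where B: "\<And>x. norm x \<le> R \<Longrightarrow> norm (G x) \<le> B"
    by (metis (no_types) bounded_iff compact_imp_bounded imageI mem_cball_0)
  have "(\<integral>\<^sup>+x. ennreal (norm (norm (G x) powr p / norm x powr \<alpha>)) \<partial>lebesgue)
      \<le> (\<integral>\<^sup>+x. ennreal (B powr p) * (ennreal (norm (x::'a) powr - \<alpha>) * indicator (cball 0 R) x) \<partial>lborel)"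
    unfolding nn_integral_completion
  proof (rule nn_integral_mono)
    fix x :: 'a
    show "ennreal (norm (norm (G x) powr p / norm x powr \<alpha>))
        \<le> ennreal (B powr p) * (ennreal (norm x powr - \<alpha>) * indicator (cball 0 R) x)"
    proof (cases "norm x \<le> R")
      case True
      then have "norm (G x) powr p / norm x powr \<alpha> \<le> B powr p * norm x powr - \<alpha>"
        using B p by (auto simp: powr_minus divide_inverse intro!: mult_right_mono powr_mono2)
      then show ?thesis
        using True by (simp add: ennreal_leI flip: ennreal_mult)
    next
      case False
      then have "G x = 0"
        using has_continuous_gradient_zero_outside[OF uG supp] by simp
      then show ?thesis
        by simp
    qed
  qed
  also have "\<dots> = ennreal (B powr p) * (\<integral>\<^sup>+x. ennreal (norm (x::'a) powr - \<alpha>) * indicator (cball 0 R) x \<partial>lborel)"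
    by (intro nn_integral_cmult borel_measurable_times_ennreal borel_measurable_indicator) auto
  also have "\<dots> < top"
    using nn_integral_powr_norm_ball_finite[OF \<alpha>, of R] by (simp add: ennreal_mult_less_top)
  finally show ?thesis
    by (intro integrableI_bounded measurable_completion) auto
qed

theorem theorem1p2:
  fixes g :: "real ^ 'n \<Rightarrow> real" and p \<alpha> q :: real
  assumes "CARD('n) \<ge> 2"
    and "1 < p"
    and "real CARD('n) > p + \<alpha>"
    and "(p < real CARD('n) - 1 \<and> q = (real CARD('n) - 1) / p) \<or>
         (p > real CARD('n) - 1 \<and> q = 1) \<or>
         (p = real CARD('n) - 1 \<and> q > 1)"
    and "Lq_sphere q g"
  shows "\<exists>C>0. \<forall>u. smooth_compactly_supported u \<longrightarrow>
           integrable lebesgue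
             (\<lambda>x. g (x /\<^sub>R norm x) / norm x powr (p + \<alpha>) * \<bar>u x\<bar> powr p) \<and>
           integrable lebesgue (\<lambda>x. norm (gradient u x) powr p / norm x powr \<alpha>) \<and>
           (LINT x|lebesgue. g (x /\<^sub>R norm x) / norm x powr (p + \<alpha>) * \<bar>u x\<bar> powr p)
             \<le> C * Lq_sphere_norm q g *
                 (LINT x|lebesgue. norm (gradient u x) powr p / norm x powr \<alpha>)"
proof -
  have dim: "DIM(real ^ 'n) = CARD('n)"
    by simp
  have q0: "0 < q"
    using assms(1,2,4) by auto
  obtain K where K: "K < top"
    "\<And>(u::real ^ 'n \<Rightarrow> real) G h R. has_continuous_gradient u G \<Longrightarrow> (\<And>x. R < norm x \<Longrightarrow> u x = 0) \<Longrightarrow> h \<in> borel_measurable borel \<Longrightarrow>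
      (\<integral>\<^sup>+x. h (x /\<^sub>R norm x) * ennreal (norm x powr - (p + \<alpha>)) * ennreal \<bar>u x\<bar> epowr p \<partial>lborel)
      \<le> K * (\<integral>\<^sup>+\<theta>. h \<theta> epowr q \<partial>borel_sphere_measure) epowr (1 / q) *
        (\<integral>\<^sup>+x. ennreal (norm x powr - \<alpha>) * ennreal (norm (G x)) epowr p \<partial>lborel)"
    using nn_integral_weighted_Hardy[where 'a="real ^ 'n", unfolded dim, OF assms(1-4)] by blast
  obtain k where k [measurable]: "k \<in> borel_measurable borel"
    and gk: "AE x in lborel. g (x /\<^sub>R norm x) = k (x /\<^sub>R norm x)"
    and norm_k: "(\<integral>\<^sup>+\<theta>. ennreal \<bar>k \<theta>\<bar> epowr q \<partial>borel_sphere_measure) epowr (1 / q) = ennreal (Lq_sphere_norm q g)"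
    using Lq_sphere_borel_representative[OF assms(5) q0] by blast
  have norm0: "0 \<le> Lq_sphere_norm q g"
    by (simp add: Lq_sphere_norm_def)
  \<comment> \<open>Adding \<open>1\<close> makes the constant positive.\<close>
  define C where "C = enn2real K + 1"
  have C: "0 < C" "K \<le> ennreal C"
    using K(1) by (auto simp: C_def add_nonneg_pos ennreal_plus[OF enn2real_nonneg] simp del: ennreal_plus)
  show ?thesis
  proof (intro exI[of _ C] conjI allI impI)
    show "0 < C"
      by (rule C)
  next
    fix u :: "real ^ 'n \<Rightarrow> real"
    assume u: "smooth_compactly_supported u"
    define G where "G = gradient u"
    have uG: "has_continuous_gradient u G"
      using u unfolding G_def smooth_compactly_supported_def by (blast intro: smooth_has_continuous_gradient)
    have "bounded {x. u x \<noteq> 0}"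
      using u unfolding smooth_compactly_supported_def
      by (meson bounded_subset closure_subset compact_imp_bounded)
    then obtain R where "\<And>x. u x \<noteq> 0 \<Longrightarrow> norm x \<le> R"
      by (auto simp: bounded_iff)
    then have supp: "u x = 0" if "R < norm x" for x
      using that by force
    have [measurable]: "u \<in> borel_measurable borel"
      using has_continuous_gradientD(3)[OF uG] by (rule borel_measurable_continuous_onI)
    let ?f = "\<lambda>x. g (x /\<^sub>R norm x) / norm x powr (p + \<alpha>) * \<bar>u x\<bar> powr p"
    let ?k = "\<lambda>x. k (x /\<^sub>R norm x) / norm x powr (p + \<alpha>) * \<bar>u x\<bar> powr p"
    let ?d = "\<lambda>x. norm (G x) powr p / norm x powr \<alpha>"
    have d: "integrable lebesgue ?d"
      using assms by (intro integrable_gradient_powr[OF uG supp]) auto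
    then show "integrable lebesgue (\<lambda>x. norm (gradient u x) powr p / norm x powr \<alpha>)"
      by (simp add: G_def)
    have "?k \<in> borel_measurable lborel"
      by measurable
    then have k_meas: "?k \<in> borel_measurable lebesgue"
      by (rule measurable_completion)
    have fk: "AE x in lborel. ?k x = ?f x"
      using gk by eventually_elim simp
    have f_meas: "?f \<in> borel_measurable lebesgue"
      by (rule borel_measurable_AE[OF k_meas AE_completion[OF fk]])
    have "(\<integral>\<^sup>+x. ennreal (norm (?f x)) \<partial>lebesgue) = (\<integral>\<^sup>+x. ennreal (norm (?f x)) \<partial>lborel)"
      by (rule nn_integral_completion)
    also have "\<dots> = (\<integral>\<^sup>+x. ennreal \<bar>k (x /\<^sub>R norm x)\<bar> * ennreal (norm x powr - (p + \<alpha>)) * ennreal \<bar>u x\<bar> epowr p \<partial>lborel)"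
    proof (rule nn_integral_cong_AE)
      show "AE x in lborel. ennreal (norm (?f x))
          = ennreal \<bar>k (x /\<^sub>R norm x)\<bar> * ennreal (norm x powr - (p + \<alpha>)) * ennreal \<bar>u x\<bar> epowr p"
        using gk
      proof eventually_elim
        case (elim x)
        have "norm (?f x) = \<bar>k (x /\<^sub>R norm x)\<bar> * norm x powr - (p + \<alpha>) * \<bar>u x\<bar> powr p"
          unfolding elim by (simp add: abs_mult powr_minus divide_inverse del: minus_add_distrib)
        then show ?case
          by (simp add: ennreal_mult ennreal_epowr)
      qed
    qed
    also have "\<dots> \<le> K * ennreal (Lq_sphere_norm q g) *
        (\<integral>\<^sup>+x. ennreal (norm x powr - \<alpha>) * ennreal (norm (G x)) epowr p \<partial>lborel)"
      unfolding norm_k[symmetric] by (rule K(2)[OF uG supp]) auto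
    also have "(\<integral>\<^sup>+x. ennreal (norm x powr - \<alpha>) * ennreal (norm (G x)) epowr p \<partial>lborel)
        = (\<integral>\<^sup>+x. ennreal (?d x) \<partial>lebesgue)"
      unfolding nn_integral_completion
      by (intro nn_integral_cong)
         (simp add: ennreal_epowr powr_minus divide_inverse mult.commute flip: ennreal_mult)
    also have "\<dots> = ennreal (LINT x|lebesgue. ?d x)"
      using d by (intro nn_integral_eq_integral) auto
    also have "K * ennreal (Lq_sphere_norm q g) * \<dots>
        \<le> ennreal C * ennreal (Lq_sphere_norm q g) * ennreal (LINT x|lebesgue. ?d x)"
      by (intro mult_right_mono C) auto
    also have "\<dots> = ennreal (C * Lq_sphere_norm q g * (LINT x|lebesgue. ?d x))"
      using C norm0 by (simp add: ennreal_mult integral_nonneg)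
    finally have bound: "(\<integral>\<^sup>+x. ennreal (norm (?f x)) \<partial>lebesgue)
        \<le> ennreal (C * Lq_sphere_norm q g * (LINT x|lebesgue. ?d x))" .
    show f_int: "integrable lebesgue ?f"
      using f_meas order_le_less_trans[OF bound ennreal_less_top]
      unfolding infinity_ennreal_def[symmetric] by (rule integrableI_bounded)
    have "ennreal \<bar>LINT x|lebesgue. ?f x\<bar> \<le> (\<integral>\<^sup>+x. ennreal (norm (?f x)) \<partial>lebesgue)"
      using integral_norm_bound_ennreal[OF f_int] by simp
    then have "ennreal \<bar>LINT x|lebesgue. ?f x\<bar> \<le> ennreal (C * Lq_sphere_norm q g * (LINT x|lebesgue. ?d x))"
      using bound by (rule order_trans)
    then have "\<bar>LINT x|lebesgue. ?f x\<bar> \<le> C * Lq_sphere_norm q g * (LINT x|lebesgue. ?d x)"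
      using C norm0 by (subst (asm) ennreal_le_iff) (auto intro!: mult_nonneg_nonneg integral_nonneg)
    then show "(LINT x|lebesgue. ?f x) \<le> C * Lq_sphere_norm q g *
        (LINT x|lebesgue. norm (gradient u x) powr p / norm x powr \<alpha>)"
      by (simp add: G_def)
  qed
qed

end
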